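(* Let $X$ and $Y$ be finite-dimensional normed spaces over the same field $\mathbb{K}\in\{\mathbb{R},\mathbb{C}\}$, and assume that at least one of them is Euclidean. Then the pair $(X,Y)$ has the nuclear tensorization property, i.e. $\tau_\infty(T)=\|T\|_{N(X\to Y)}$ for every linear operator $T:X\to Y$.
   Context: For a finite-dimensional normed space $X$ with dual $X^*$ and dual unit ball $B_{X^*}$, and an integer $k\ge 1$, the algebraic tensor power $X^{\otimes k}$ carries the injective norm $\|z\|_{\varepsilon_k(X)}=\sup\{|(\lambda_1\otimes\cdots\otimes\lambda_k)(z)| : \lambda_1,\dots,\lambda_k\in B_{X^*}\}$ and the projective norm $\|z\|_{\pi_k(X)}=\inf\{\sum_{i=1}^m \|x_i^{(1)}\|_X\cdots\|x_i^{(k)}\|_X : m\in\mathbb{N},\ z=\sum_{i=1}^m x_i^{(1)}\otimes\cdots\otimes x_i^{(k)}\}$. For a linear operator $T:X\to Y$, $\tau_k(T)=\left(\sup_{z\in X^{\otimes k},\,z\neq 0}\frac{\|T^{\otimes k}z\|_{\pi_k(Y)}}{\|z\|_{\varepsilon_k(X)}}\right)^{1/k}$ and the tensor radius of $T$ is $\tau_\infty(T)=\lim_{k\to\infty}\tau_k(T)$ (this limit exists). The nuclear norm is $\|T\|_{N(X\to Y)}=\inf \sum_i \|y_i\|_Y\|x_i^*\|_{X^*}$, the infimum being over finite decompositions $T(\cdot)=\sum_i x_i^*(\cdot)y_i$ with $x_i^*\in X^*$, $y_i\in Y$. A normed space is Euclidean if its norm is induced by an inner product. *)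

theory Defs
  imports Complex_Main "HOL-Library.Function_Algebras"
begin

section \<open>Finite-dimensional normed spaces\<close>

text \<open>
  The distribution has no type class of complex normed spaces. To treat real and complex spaces
  at once, a normed space is given by its scalar multiplication and its norm; the definitions below
  are used with the scalar field \<open>'k\<close> equal to \<open>real\<close> or \<open>complex\<close>. The whole type \<open>'a\<close> is the space.
\<close>

locale fin_dim_normed_space = vector_space scale
  for scale :: "'k::real_normed_field \<Rightarrow> 'a::ab_group_add \<Rightarrow> 'a" +
  fixes nrm :: "'a \<Rightarrow> real"
  assumes finite_dim: "\<exists>B. finite B \<and> span B = UNIV"
    and nrm_eq_0_iff: "nrm x = 0 \<longleftrightarrow> x = 0"
    and nrm_triangle: "nrm (x + y) \<le> nrm x + nrm y"
    and nrm_scale: "nrm (scale c x) = norm c * nrm x"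

text \<open>
  The parameter \<open>cj\<close> is the conjugation of the scalar field: the identity on \<open>real\<close>, \<^const>\<open>cnj\<close> on
  \<open>complex\<close>. Inner products are linear in the first argument.
\<close>

definition is_inner_product ::
    "('k::real_normed_field \<Rightarrow> 'k) \<Rightarrow> ('k \<Rightarrow> 'a::ab_group_add \<Rightarrow> 'a) \<Rightarrow> ('a \<Rightarrow> 'a \<Rightarrow> 'k) \<Rightarrow> bool" where
  "is_inner_product cj s ip \<longleftrightarrow>
     (\<forall>y. Vector_Spaces.linear s (*) (\<lambda>x. ip x y)) \<and>
     (\<forall>x y. ip y x = cj (ip x y)) \<and>
     (\<forall>x. x \<noteq> 0 \<longrightarrow> (\<exists>r>0. ip x x = of_real r))"

definition euclidean_norm ::
    "('k::real_normed_field \<Rightarrow> 'k) \<Rightarrow> ('k \<Rightarrow> 'a::ab_group_add \<Rightarrow> 'a) \<Rightarrow> ('a \<Rightarrow> real) \<Rightarrow> bool" where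
  "euclidean_norm cj s nrm \<longleftrightarrow>
     (\<exists>ip. is_inner_product cj s ip \<and> (\<forall>x. of_real ((nrm x)\<^sup>2) = ip x x))"

definition dual_space ::
    "('k::real_normed_field \<Rightarrow> 'a::ab_group_add \<Rightarrow> 'a) \<Rightarrow> ('a \<Rightarrow> 'k) set" where
  "dual_space s = {f. Vector_Spaces.linear s (*) f}"

definition dual_norm :: "('a \<Rightarrow> real) \<Rightarrow> ('a \<Rightarrow> 'k::real_normed_field) \<Rightarrow> real" where
  "dual_norm nrm f = Sup {norm (f x) | x. nrm x \<le> 1}"

definition dual_ball ::
    "('k::real_normed_field \<Rightarrow> 'a::ab_group_add \<Rightarrow> 'a) \<Rightarrow> ('a \<Rightarrow> real) \<Rightarrow> ('a \<Rightarrow> 'k) set" where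
  "dual_ball s nrm = {f \<in> dual_space s. dual_norm nrm f \<le> 1}"

section \<open>Tensor powers\<close>

text \<open>Elements of \<open>X\<^sup>k\<close> are lists of length \<open>k\<close>; a form is only relevant on such lists.\<close>

definition multilinear_form ::
    "('k::field \<Rightarrow> 'a::ab_group_add \<Rightarrow> 'a) \<Rightarrow> nat \<Rightarrow> ('a list \<Rightarrow> 'k) \<Rightarrow> bool" where
  "multilinear_form s k A \<longleftrightarrow>
     (\<forall>xs i. length xs = k \<longrightarrow> i < k \<longrightarrow> Vector_Spaces.linear s (*) (\<lambda>x. A (xs[i := x])))"

text \<open>
  As usual in the theory of tensor norms, \<open>x\<^sub>1 \<otimes> \<dots> \<otimes> x\<^sub>k\<close> is evaluation at \<open>(x\<^sub>1, \<dots>, x\<^sub>k)\<close> on the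
  space of \<open>k\<close>-linear forms, and the algebraic tensor power is the linear span of these
  evaluations. So the value \<open>z A\<close> is the linear form on the tensor power induced by the
  \<open>k\<close>-linear form \<open>A\<close>, applied to \<open>z\<close>. Tensors are made \<open>0\<close> outside the multilinear forms so that
  equality of tensors is equality of functions.
\<close>

type_synonym ('a, 'k) tensor = "('a list \<Rightarrow> 'k) \<Rightarrow> 'k"

definition elementary_tensor ::
    "('k::field \<Rightarrow> 'a::ab_group_add \<Rightarrow> 'a) \<Rightarrow> nat \<Rightarrow> 'a list \<Rightarrow> ('a, 'k) tensor" where
  "elementary_tensor s k xs = (\<lambda>A. if multilinear_form s k A then A xs else 0)"

definition tensor_power ::
    "('k::field \<Rightarrow> 'a::ab_group_add \<Rightarrow> 'a) \<Rightarrow> nat \<Rightarrow> ('a, 'k) tensor set" where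
  "tensor_power s k =
     module.span (\<lambda>c z A. c * z A) (elementary_tensor s k ` {xs. length xs = k})"

definition functional_tensor :: "('a \<Rightarrow> 'k::field) list \<Rightarrow> 'a list \<Rightarrow> 'k" where
  "functional_tensor \<phi>s = (\<lambda>xs. \<Prod>i<length \<phi>s. (\<phi>s ! i) (xs ! i))"

text \<open>
  \<open>T\<^sup>\<otimes>\<^sup>k\<close> is the transpose of the pullback of \<open>k\<close>-linear forms along \<open>T\<close>; see
  \<open>tensor_map_elementary\<close> below.
\<close>

definition tensor_map ::
    "('k::field \<Rightarrow> 'b::ab_group_add \<Rightarrow> 'b) \<Rightarrow> nat \<Rightarrow> ('a \<Rightarrow> 'b) \<Rightarrow> ('a, 'k) tensor \<Rightarrow> ('b, 'k) tensor" where
  "tensor_map sY k T z = (\<lambda>B. if multilinear_form sY k B then z (\<lambda>xs. B (map T xs)) else 0)"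

definition injective_norm ::
    "('k::real_normed_field \<Rightarrow> 'a::ab_group_add \<Rightarrow> 'a) \<Rightarrow> ('a \<Rightarrow> real) \<Rightarrow> nat \<Rightarrow> ('a, 'k) tensor \<Rightarrow> real"
  where
  "injective_norm s nrm k z =
     Sup {norm (z (functional_tensor \<phi>s)) | \<phi>s. length \<phi>s = k \<and> set \<phi>s \<subseteq> dual_ball s nrm}"

definition projective_norm ::
    "('k::real_normed_field \<Rightarrow> 'a::ab_group_add \<Rightarrow> 'a) \<Rightarrow> ('a \<Rightarrow> real) \<Rightarrow> nat \<Rightarrow> ('a, 'k) tensor \<Rightarrow> real"
  where
  "projective_norm s nrm k z =
     Inf {\<Sum>i<m. \<Prod>j<k. nrm (x i ! j) | (m::nat) (x :: nat \<Rightarrow> 'a list).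
            (\<forall>i<m. length (x i) = k) \<and> z = (\<Sum>i<m. elementary_tensor s k (x i))}"

section \<open>Tensor radius and nuclear norm\<close>

text \<open>
  The quotients are nonnegative, so inserting \<open>0\<close> only matters when \<open>X\<close> is the zero space, where
  the supremum of the empty set has to be read as \<open>0\<close>. Only \<open>k \<ge> 1\<close> is meaningful.
\<close>

definition tensor_tau ::
    "('k::real_normed_field \<Rightarrow> 'a::ab_group_add \<Rightarrow> 'a) \<Rightarrow> ('a \<Rightarrow> real) \<Rightarrow>
     ('k \<Rightarrow> 'b::ab_group_add \<Rightarrow> 'b) \<Rightarrow> ('b \<Rightarrow> real) \<Rightarrow> nat \<Rightarrow> ('a \<Rightarrow> 'b) \<Rightarrow> real" where
  "tensor_tau sX nX sY nY k T =
     root k (Sup (insert 0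
       {projective_norm sY nY k (tensor_map sY k T z) / injective_norm sX nX k z | z.
          z \<in> tensor_power sX k \<and> z \<noteq> 0}))"

definition tensor_radius ::
    "('k::real_normed_field \<Rightarrow> 'a::ab_group_add \<Rightarrow> 'a) \<Rightarrow> ('a \<Rightarrow> real) \<Rightarrow>
     ('k \<Rightarrow> 'b::ab_group_add \<Rightarrow> 'b) \<Rightarrow> ('b \<Rightarrow> real) \<Rightarrow> ('a \<Rightarrow> 'b) \<Rightarrow> real" where
  "tensor_radius sX nX sY nY T = lim (\<lambda>k. tensor_tau sX nX sY nY k T)"

definition nuclear_norm ::
    "('k::real_normed_field \<Rightarrow> 'a::ab_group_add \<Rightarrow> 'a) \<Rightarrow> ('a \<Rightarrow> real) \<Rightarrow>
     ('k \<Rightarrow> 'b::ab_group_add \<Rightarrow> 'b) \<Rightarrow> ('b \<Rightarrow> real) \<Rightarrow> ('a \<Rightarrow> 'b) \<Rightarrow> real" where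
  "nuclear_norm sX nX sY nY T =
     Inf {\<Sum>i<m. nY (y i) * dual_norm nX (f i) | (m::nat) (f :: nat \<Rightarrow> 'a \<Rightarrow> 'k) (y :: nat \<Rightarrow> 'b).
            (\<forall>i<m. f i \<in> dual_space sX) \<and> (\<forall>x. T x = (\<Sum>i<m. sY (f i x) (y i)))}"

text \<open>Since \<^const>\<open>lim\<close> is total, the existence of the limit is stated explicitly.\<close>

definition nuclear_tensorization_property ::
    "('k::real_normed_field \<Rightarrow> 'a::ab_group_add \<Rightarrow> 'a) \<Rightarrow> ('a \<Rightarrow> real) \<Rightarrow>
     ('k \<Rightarrow> 'b::ab_group_add \<Rightarrow> 'b) \<Rightarrow> ('b \<Rightarrow> real) \<Rightarrow> bool" where
  "nuclear_tensorization_property sX nX sY nY \<longleftrightarrow>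
     (\<forall>T. Vector_Spaces.linear sX sY T \<longrightarrow>
        convergent (\<lambda>k. tensor_tau sX nX sY nY k T) \<and>
        tensor_radius sX nX sY nY T = nuclear_norm sX nX sY nY T)"

section \<open>Sanity checks for the tensor calculus\<close>

lemma multilinear_form_pullback:
  assumes "Vector_Spaces.linear sX sY T" and "multilinear_form sY k B"
  shows "multilinear_form sX k (\<lambda>xs. B (map T xs))"
  unfolding multilinear_form_def
proof (intro allI impI)
  fix xs :: "'b list" and i
  assume "length xs = k" "i < k"
  then have "Vector_Spaces.linear sY (*) (\<lambda>y. B ((map T xs)[i := y]))"
    using assms(2) by (simp add: multilinear_form_def)
  from Vector_Spaces.linear_compose[OF assms(1) this]
  show "Vector_Spaces.linear sX (*) (\<lambda>x. B (map T (xs[i := x])))"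
    by (simp add: o_def map_update)
qed

lemma tensor_map_elementary:
  assumes "Vector_Spaces.linear sX sY T"
  shows "tensor_map sY k T (elementary_tensor sX k xs) = elementary_tensor sY k (map T xs)"
  using multilinear_form_pullback[OF assms]
  by (auto simp: tensor_map_def elementary_tensor_def fun_eq_iff)

lemma multilinear_form_functional_tensor:
  assumes "vector_space s" "length \<phi>s = k" "set \<phi>s \<subseteq> dual_space s"
  shows "multilinear_form s k (functional_tensor \<phi>s)"
  unfolding multilinear_form_def
proof (intro allI impI)
  fix xs :: "'b list" and i
  assume xs: "length xs = k" and i: "i < k"
  let ?c = "\<Prod>j\<in>{..<k} - {i}. (\<phi>s ! j) (xs ! j)"
  have eq: "functional_tensor \<phi>s (xs[i := x]) = (\<phi>s ! i) x * ?c" for x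
    using xs i assms(2) by (simp add: functional_tensor_def prod.remove[of _ i])
  have "\<phi>s ! i \<in> dual_space s"
    using assms(2,3) i by (metis nth_mem subsetD)
  then have "Vector_Spaces.linear s (*) (\<phi>s ! i)"
    by (simp add: dual_space_def)
  then have "Vector_Spaces.linear s (*) (\<lambda>x. (\<phi>s ! i) x * ?c)"
    by (auto simp: Vector_Spaces.linear_iff algebra_simps)
  then show "Vector_Spaces.linear s (*) (\<lambda>x. functional_tensor \<phi>s (xs[i := x]))"
    by (simp add: eq)
qed

lemma functional_tensor_elementary:
  assumes "vector_space s" "length \<phi>s = k" "set \<phi>s \<subseteq> dual_space s"
  shows "elementary_tensor s k xs (functional_tensor \<phi>s) = (\<Prod>i<k. (\<phi>s ! i) (xs ! i))"
  using multilinear_form_functional_tensor[OF assms] assms(2)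
  by (simp add: elementary_tensor_def functional_tensor_def)

end

(*
  Upper bound: a nuclear representation T = sum_i g_i (x) y_i expands T^(x)k z into elementary
  tensors whose coefficients are values of z on products of functionals.

  Lower bound: by Hahn-Banach on the space of operators with the nuclear norm there is a norming
  functional for T, i.e. an operator S from Y to X of norm at most 1 with tr(ST) equal to the
  nuclear norm. As X or Y is Euclidean, S is given by vectors x_i of X and functionals g_i on Y
  that factor it through l_2^n. For random signs e_I indexed by I in {1..n}^k, test T^(x)k on
  z = sum_I e_I x_{I_1} (x) ... (x) x_{I_k} against the form B = sum_J e_J g_{J_1} (x) ... (x) g_{J_k}.
  The mean of B(T^(x)k z) is tr(ST)^k. Both the injective norm of z and the norm of B are at most
  the supremum M of the sign form over products of Euclidean unit balls; M is estimated on a fixed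
  delta-net by 2k-th moments, so that E M^2 is at most C k^2 (1 - delta)^(-2k). The factor C k^2
  disappears under k-th roots, and finally delta tends to 0.
*)

theory Submission
  imports Defs "HOL-Analysis.Convex"
begin

subsection \<open>Real and complex scalars\<close>

text \<open>The Euclidean hypothesis serves to factor \<open>S\<close>. Between general spaces a
  contraction factors through \<open>l_2^n\<close> only at a cost that may exceed 1, and the k-th
  power of this cost would survive the k-th root; with a Euclidean space at one end the cost is 1.

  The obstacle in the lower bound is the size of \<open>M\<close>: with all signs equal to 1 it is
  \<open>n^(k/2)\<close>, which can swamp \<open>tr(ST)^k\<close>. For random signs it is polynomial
  in \<open>k\<close> up to the loss from the net. A union over the \<open>|N|^k\<close> points of
  the product net is affordable because it enters through the 2k-th moment: the power 1/k turns it
  into the constant \<open>|N|\<close>. For the same reason a moment bound of the form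
  \<open>(C k^2)^k\<close> is good enough and sharp constants are beside the point.

  The same signs stand in \<open>z\<close> and in \<open>B\<close>, so that averaging keeps exactly
  the diagonal \<open>I = J\<close>. A single choice of signs has to make the quadratic form large
  relative to \<open>M\<close>; this is obtained by comparing two averages, rather than from two
  separate events.\<close>

text \<open>
  The element \<open>w\<close> stands for the imaginary unit of the scalar field and is \<open>0\<close> for the real field,
  so that both fields are covered by \<open>c = re c + w im c\<close>.
\<close>

locale scalars =
  fixes cj :: "'k::real_normed_field \<Rightarrow> 'k"
    and re im :: "'k \<Rightarrow> real"
    and w :: 'k
  assumes re_add: "re (a + b) = re a + re b"
    and im_add: "im (a + b) = im a + im b"
    and re_of_real_mult: "re (of_real r * a) = r * re a"
    and im_of_real_mult: "im (of_real r * a) = r * im a"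
    and re_of_real: "re (of_real r) = r"
    and im_of_real: "im (of_real r) = 0"
    and decomp: "a = of_real (re a) + w * of_real (im a)"
    and w_sq: "w = 0 \<or> w * w = - 1"
    and re_w_mult: "re (w * of_real r) = 0"
    and norm_sq: "(norm a)\<^sup>2 = (re a)\<^sup>2 + (im a)\<^sup>2"
    and norm_sq_le: "(norm (of_real x + w * of_real y))\<^sup>2 \<le> x\<^sup>2 + y\<^sup>2"
    and mult_cj: "a * cj a = of_real ((norm a)\<^sup>2)"
    and norm_cj: "norm (cj a) = norm a"
    and cj_of_real: "cj (of_real r) = of_real r"
begin

lemma re_0: "re 0 = 0"
  using re_of_real[of 0] by simp

lemma im_0: "im 0 = 0"
  using im_of_real[of 0] by simp

lemma re_sum: "re (\<Sum>i\<in>I. f i) = (\<Sum>i\<in>I. re (f i))"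
  by (induction I rule: infinite_finite_induct) (auto simp: re_add re_0)

lemma im_sum: "im (\<Sum>i\<in>I. f i) = (\<Sum>i\<in>I. im (f i))"
  by (induction I rule: infinite_finite_induct) (auto simp: im_add im_0)

lemma abs_re_le: "\<bar>re a\<bar> \<le> norm a"
  by (rule abs_le_square_iff[THEN iffD2, of "re a" "norm a", simplified]) (simp add: norm_sq)

lemma abs_im_le: "\<bar>im a\<bar> \<le> norm a"
  by (rule abs_le_square_iff[THEN iffD2, of "im a" "norm a", simplified]) (simp add: norm_sq)

lemma norm_w_le: "norm w \<le> 1"
proof -
  have "norm w = 1" if "w * w = - 1"
  proof -
    have "(norm w)\<^sup>2 = 1"
      using arg_cong[OF that, of norm] by (simp add: norm_mult power2_eq_square)
    then show ?thesis
      by (simp add: power2_eq_1_iff) (use norm_ge_zero[of w] in linarith)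
  qed
  then show ?thesis
    using w_sq by force
qed

text \<open>Rotating a value to the nonnegative reals turns a bound on real parts into a bound on
  norms.\<close>

lemma unimodular_rotation:
  fixes a :: 'k
  obtains \<theta> where "norm \<theta> = 1" "\<theta> * a = of_real (norm a)"
proof (cases "a = 0")
  case True
  then show ?thesis
    by (intro that[of 1]) simp_all
next
  case False
  let ?t = "cj a / of_real (norm a)"
  have "norm ?t = 1"
    using False by (simp add: norm_divide norm_cj)
  moreover have "?t * a = of_real (norm a)"
    using False mult_cj[of a] by (simp add: field_simps power2_eq_square)
  ultimately show ?thesis
    using that by blast
qed

end

subsection \<open>The Hahn--Banach theorem on a finitely spanned subspace\<close>

text \<open>
  Sublinear functionals are made linear in one direction \<open>v\<close> at a time, by passing to
  \<open>x \<mapsto> inf\<^sub>t\<^sub>\<ge>\<^sub>0 (p (x + t v) - t p v)\<close>. Working with the functional on the whole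
  subspace avoids the extension of partially defined functionals.
\<close>

definition sublinear_on :: "('k::real_normed_field \<Rightarrow> 'v::ab_group_add \<Rightarrow> 'v) \<Rightarrow> 'v set \<Rightarrow> ('v \<Rightarrow> real) \<Rightarrow> bool" where
  "sublinear_on s W p \<longleftrightarrow>
     (\<forall>x\<in>W. \<forall>y\<in>W. p (x + y) \<le> p x + p y) \<and>
     (\<forall>x\<in>W. \<forall>r\<ge>0. p (s (of_real r) x) = r * p x)"

locale vector_space_over_normed_field = vector_space scale
  for scale :: "'k::real_normed_field \<Rightarrow> 'b::ab_group_add \<Rightarrow> 'b"
begin

lemma sublinear_on_0:
  assumes "sublinear_on scale W p" "subspace W"
  shows "p 0 = 0"
proof -
  have "p (scale (of_real 0) 0) = 0 * p 0"
    using assms subspace_0[OF assms(2)] unfolding sublinear_on_def by blast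
  then show ?thesis by simp
qed

text \<open>The infimum stays finite because \<open>p (x + t v) \<ge> t p v - p (- x)\<close>. The
  equation \<open>q v = p v\<close> is kept for the vector at which the final functional is to be
  norming.\<close>

lemma sublinear_linearize_direction:
  fixes p :: "'b \<Rightarrow> real"
  assumes p: "sublinear_on scale W p" and W: "subspace W" and v: "v \<in> W"
  obtains q where "sublinear_on scale W q" "\<And>x. x \<in> W \<Longrightarrow> q x \<le> p x" "q (- v) = - q v" "q v = p v"
proof -
  have tri: "p (x + y) \<le> p x + p y" if "x \<in> W" "y \<in> W" for x y
    using p that by (auto simp: sublinear_on_def)
  have hom: "p (scale (of_real r) x) = r * p x" if "x \<in> W" "r \<ge> 0" for x r
    using p that by (auto simp: sublinear_on_def)
  have mem: "scale (of_real r) x \<in> W" "- x \<in> W" if "x \<in> W" for r x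
    using that W by (auto intro: subspace_scale subspace_neg)
  let ?S = "\<lambda>x. (\<lambda>t. p (x + scale (of_real t) v) - t * p v) ` {0..}"
  define q where "q x = Inf (?S x)" for x
  have bdd: "bdd_below (?S x)" if x: "x \<in> W" for x
  proof (rule bdd_belowI2)
    fix t :: real assume t: "t \<in> {0..}"
    have "p ((x + scale (of_real t) v) + (- x)) \<le> p (x + scale (of_real t) v) + p (- x)"
      by (intro tri mem subspace_add W x v)
    then show "- p (- x) \<le> p (x + scale (of_real t) v) - t * p v"
      using hom[OF v, of t] t by simp
  qed
  have q_le: "q x \<le> p (x + scale (of_real t) v) - t * p v" if "x \<in> W" "t \<ge> 0" for x t
    unfolding q_def using that by (intro cInf_lower bdd imageI) auto
  have q_ge: "c \<le> q x" if "\<And>t. t \<ge> 0 \<Longrightarrow> c \<le> p (x + scale (of_real t) v) - t * p v" for c x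
    unfolding q_def using that by (intro cInf_greatest) auto
  have q_p: "q x \<le> p x" if "x \<in> W" for x
    using q_le[OF that, of 0] by simp
  have add: "q (x + y) \<le> q x + q y" if x: "x \<in> W" and y: "y \<in> W" for x y
  proof -
    have "q (x + y) - (p (y + scale (of_real u) v) - u * p v) \<le> q x" if u: "u \<ge> 0" for u
    proof (rule q_ge)
      fix t :: real assume t: "t \<ge> 0"
      have eq: "(x + y) + scale (of_real (t + u)) v = (x + scale (of_real t) v) + (y + scale (of_real u) v)"
        by (simp add: scale_left_distrib algebra_simps)
      have "q (x + y) \<le> p ((x + y) + scale (of_real (t + u)) v) - (t + u) * p v"
        using t u x y by (intro q_le subspace_add W) auto
      also have "p ((x + y) + scale (of_real (t + u)) v) \<le> p (x + scale (of_real t) v) + p (y + scale (of_real u) v)"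
        unfolding eq by (intro tri mem subspace_add W x y v)
      finally show "q (x + y) - (p (y + scale (of_real u) v) - u * p v) \<le> p (x + scale (of_real t) v) - t * p v"
        by (simp add: algebra_simps)
    qed
    then have "q (x + y) - q x \<le> q y"
      by (intro q_ge) (auto simp: algebra_simps)
    then show ?thesis by simp
  qed
  have scale_le: "q (scale (of_real r) x) \<le> r * q x" if x: "x \<in> W" and r: "r > 0" for r x
  proof -
    have "q (scale (of_real r) x) / r \<le> q x"
    proof (rule q_ge)
      fix t :: real assume t: "t \<ge> 0"
      have "q (scale (of_real r) x) \<le> p (scale (of_real r) x + scale (of_real (r * t)) v) - (r * t) * p v"
        using x t r by (intro q_le mem) auto
      also have "scale (of_real r) x + scale (of_real (r * t)) v = scale (of_real r) (x + scale (of_real t) v)"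
        by (simp add: scale_right_distrib)
      also have "p \<dots> = r * p (x + scale (of_real t) v)"
        using r by (intro hom subspace_add W x mem v) auto
      finally show "q (scale (of_real r) x) / r \<le> p (x + scale (of_real t) v) - t * p v"
        using r by (simp add: field_simps)
    qed
    then show ?thesis using r by (simp add: field_simps)
  qed
  have q0: "q 0 = 0"
  proof -
    have "q 0 \<le> p 0" by (intro q_p subspace_0 W)
    moreover have "0 \<le> q 0"
      by (rule q_ge) (simp add: hom v)
    ultimately show ?thesis using sublinear_on_0[OF p W] by simp
  qed
  have sub: "sublinear_on scale W q"
    unfolding sublinear_on_def
  proof (intro conjI ballI allI impI add)
    fix x r assume x: "x \<in> W" and r: "(r::real) \<ge> 0"
    show "q (scale (of_real r) x) = r * q x"
    proof (cases "r = 0")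
      case False
      with r have r: "r > 0" by simp
      have "q (scale (of_real (1 / r)) (scale (of_real r) x)) \<le> (1 / r) * q (scale (of_real r) x)"
        by (rule scale_le) (use x r mem in auto)
      moreover have "scale (of_real (1 / r)) (scale (of_real r) x) = x"
        using r by (simp flip: of_real_mult)
      ultimately show ?thesis
        using scale_le[OF x r] r by (simp add: field_simps)
    qed (simp add: q0)
  qed
  \<comment> \<open>Parameter 1 at the point \<open>- v\<close> moves the argument of
    \<open>p\<close> to 0. With \<open>0 \<le> q v + q (- v)\<close> and
    \<open>q v \<le> p v\<close> this squeezes both values.\<close>
  have "q (- v) \<le> - p v"
    using q_le[of "- v" 1] mem v sublinear_on_0[OF p W] by simp
  moreover have "0 \<le> q v + q (- v)"
    using add[of v "- v"] v mem q0 by simp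
  ultimately have "q (- v) = - q v" "q v = p v"
    using q_p[OF v] by linarith+
  with sub q_p show ?thesis using that by blast
qed

text \<open>A direction treated earlier stays linear: the functionals only decrease, and
  subadditivity \<open>0 \<le> q v + q (- v)\<close> leaves no room once
  \<open>p' v + p' (- v) = 0\<close>.\<close>

lemma sublinear_linearize_finite:
  fixes p :: "'b \<Rightarrow> real"
  assumes "finite C" "sublinear_on scale W p" "subspace W" "C \<subseteq> W"
  shows "\<exists>q. sublinear_on scale W q \<and> (\<forall>x\<in>W. q x \<le> p x) \<and> (\<forall>v\<in>C. q (- v) = - q v)"
  using assms
proof (induction C arbitrary: p rule: finite_induct)
  case empty
  then show ?case by (intro exI[of _ p]) auto
next
  case (insert v C)
  obtain p' where p': "sublinear_on scale W p'" "\<And>x. x \<in> W \<Longrightarrow> p' x \<le> p x" "p' (- v) = - p' v"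
    using sublinear_linearize_direction[of W p v] insert.prems by (metis insert_subset)
  obtain q where q: "sublinear_on scale W q" "\<And>x. x \<in> W \<Longrightarrow> q x \<le> p' x" "\<And>v. v \<in> C \<Longrightarrow> q (- v) = - q v"
    using insert.IH[OF p'(1)] insert.prems by auto
  have v: "v \<in> W" "- v \<in> W" using insert.prems by (auto intro: subspace_neg)
  have "q (v + (- v)) \<le> q v + q (- v)"
    using q(1) v unfolding sublinear_on_def by blast
  then have "0 \<le> q v + q (- v)"
    using sublinear_on_0[OF q(1) insert.prems(2)] by simp
  with q(2)[OF v(1)] q(2)[OF v(2)] p'(3) have "q (- v) = - q v" by linarith
  with q p'(2) show ?case by (intro exI[of _ q]) force
qed

end

text \<open>The real part \<open>q\<close> is made linear in finitely many directions, and the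
  scalar-linear functional is recovered as \<open>q x - w q (w x)\<close>; for \<open>w = 0\<close>
  this is \<open>q\<close> itself. The direction \<open>t\<close> comes first, while
  \<open>p t\<close> is still the value to be kept.\<close>

lemma (in scalars) Hahn_Banach_finite_span:
  fixes s :: "'k \<Rightarrow> 'v::ab_group_add \<Rightarrow> 'v" and p :: "'v \<Rightarrow> real"
  assumes vs: "vector_space s" and B: "finite B" and W: "W = module.span s B"
    and tri: "\<And>x y. x \<in> W \<Longrightarrow> y \<in> W \<Longrightarrow> p (x + y) \<le> p x + p y"
    and hom: "\<And>c x. x \<in> W \<Longrightarrow> p (s c x) = norm c * p x"
    and t: "t \<in> W"
  obtains \<Phi> :: "'v \<Rightarrow> 'k" where
    "\<And>x y. x \<in> W \<Longrightarrow> y \<in> W \<Longrightarrow> \<Phi> (x + y) = \<Phi> x + \<Phi> y"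
    "\<And>c x. x \<in> W \<Longrightarrow> \<Phi> (s c x) = c * \<Phi> x"
    "\<Phi> t = of_real (p t)"
    "\<And>x. x \<in> W \<Longrightarrow> norm (\<Phi> x) \<le> p x"
proof -
  interpret vector_space_over_normed_field s
    using vs by (simp add: vector_space_over_normed_field_def)
  have subW: "subspace W" unfolding W by (rule subspace_span)
  have mem: "s c x \<in> W" if "x \<in> W" for c x
    using that subW by (rule subspace_scale[rotated])
  have memn: "- x \<in> W" if "x \<in> W" for x
    using that subW by (rule subspace_neg[rotated])
  have mema: "x + y \<in> W" if "x \<in> W" "y \<in> W" for x y
    using that subW by (simp add: subspace_add)
  have "sublinear_on s W p"
    using tri hom by (auto simp: sublinear_on_def)
  then obtain p' where p': "sublinear_on s W p'" "\<And>x. x \<in> W \<Longrightarrow> p' x \<le> p x"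
      "p' (- t) = - p' t" "p' t = p t"
    using sublinear_linearize_direction[OF _ subW t] by metis
  \<comment> \<open>These vectors span \<open>W\<close> over the reals.\<close>
  let ?C = "B \<union> s w ` B"
  have BW: "B \<subseteq> W" unfolding W by (rule span_superset)
  then have "?C \<subseteq> W" using mem by auto
  then obtain q where q: "sublinear_on s W q" "\<And>x. x \<in> W \<Longrightarrow> q x \<le> p' x"
      and qC: "\<And>v. v \<in> ?C \<Longrightarrow> q (- v) = - q v"
    using sublinear_linearize_finite[OF _ p'(1) subW, of ?C] B by auto
  have qtri: "q (x + y) \<le> q x + q y" if "x \<in> W" "y \<in> W" for x y
    using q(1) that by (auto simp: sublinear_on_def)
  have qhom: "q (s (of_real r) x) = r * q x" if "x \<in> W" "r \<ge> 0" for x r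
    using q(1) that by (auto simp: sublinear_on_def)
  \<comment> \<open>\<open>D\<close> collects the directions in which \<open>q\<close> is odd.
    Subadditivity used for \<open>u\<close> and for \<open>- u\<close> makes \<open>q\<close>
    additive along \<open>D\<close>, so that \<open>D\<close> is a real subspace; it contains the
    real spanning set, hence all of \<open>W\<close>.\<close>
  define D where "D = {v \<in> W. q (- v) = - q v}"
  have q_add: "q (x + u) = q x + q u" if "x \<in> W" "u \<in> D" for x u
    using qtri[of x u] qtri[of "x + u" "- u"] that by (auto simp: D_def memn mema)
  have D_uminus: "- u \<in> D" if "u \<in> D" for u
    using that by (auto simp: D_def memn)
  have D_add: "u + v \<in> D" if u: "u \<in> D" and v: "v \<in> D" for u v
  proof -
    have "q (- u + - v) = q (- u) + q (- v)"
      using u v by (intro q_add D_uminus) (auto simp: D_def memn)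
    then show ?thesis
      using u v q_add[of u v] by (auto simp: D_def mema add.commute)
  qed
  have D_scale: "s (of_real r) u \<in> D" if "u \<in> D" for r u
  proof -
    have nn: "s (of_real r) u \<in> D" if "r \<ge> 0" for r
      using qhom[of u r] qhom[of "- u" r] that \<open>u \<in> D\<close> by (auto simp: D_def mem memn)
    show ?thesis
      using nn[of r] D_uminus[OF nn[of "- r"]] by (cases "r \<ge> 0") auto
  qed
  have "x \<in> D" if "x \<in> module.span s B" for x
    using that
  proof (induction rule: span_induct_alt)
    case base
    show ?case
      using sublinear_on_0[OF q(1) subW] subspace_0[OF subW] by (simp add: D_def)
  next
    case (step c x y)
    have xD: "x \<in> D" "s w x \<in> D"
      using step qC BW mem by (auto simp: D_def)
    have "s c x = s (of_real (re c)) x + s (of_real (im c)) (s w x)"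
      by (subst decomp[of c]) (simp add: scale_left_distrib mult.commute)
    then show ?case
      using xD step by (auto intro!: D_add D_scale simp del: scale_scale)
  qed
  then have D: "x \<in> D" if "x \<in> W" for x using that W by auto
  have q_add: "q (x + y) = q x + q y" if "x \<in> W" "y \<in> W" for x y
    using q_add D that by auto
  have q_scale: "q (s (of_real r) x) = r * q x" if "x \<in> W" for x r
  proof (cases "r \<ge> 0")
    case False
    then have "q (s (of_real (- r)) x) = (- r) * q x"
      using that by (intro qhom) auto
    moreover have "q (- s (of_real (- r)) x) = - q (s (of_real (- r)) x)"
      using D[OF mem[OF that]] by (auto simp: D_def)
    ultimately show ?thesis by simp
  qed (use qhom that in auto)
  have q0: "q 0 = 0" by (rule sublinear_on_0[OF q(1) subW])
  have qt: "q t = p t"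
    using q(2)[OF t] q(2)[OF memn[OF t]] D[OF t] p'(3,4) by (auto simp: D_def)
  define \<Phi> :: "'v \<Rightarrow> 'k" where "\<Phi> x = of_real (q x) - w * of_real (q (s w x))" for x
  have re_Phi: "re (\<Phi> x) = q x" for x
    using re_add[of "of_real (q x)" "w * of_real (- q (s w x))"] re_w_mult[of "- q (s w x)"]
    by (simp add: \<Phi>_def re_of_real)
  have Phi_add: "\<Phi> (x + y) = \<Phi> x + \<Phi> y" if "x \<in> W" "y \<in> W" for x y
    using that by (simp add: \<Phi>_def q_add scale_right_distrib mem algebra_simps)
  have Phi_real: "\<Phi> (s (of_real r) x) = of_real r * \<Phi> x" if "x \<in> W" for r x
    using that q_scale[OF mem[OF that, of w], of r]
    by (simp add: \<Phi>_def q_scale mem algebra_simps)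
  have Phi_w: "\<Phi> (s w x) = w * \<Phi> x" if "x \<in> W" for x
    using w_sq
  proof
    assume "w = 0" then show ?thesis by (simp add: \<Phi>_def q0)
  next
    assume ww: "w * w = - 1"
    have "\<Phi> (s w x) = of_real (q (s w x)) + w * of_real (q x)"
      using q_scale[OF that, of "- 1"] by (simp add: \<Phi>_def ww)
    also have "\<dots> = w * of_real (q x) - (w * w) * of_real (q (s w x))"
      by (simp add: ww)
    also have "\<dots> = w * \<Phi> x" by (simp add: \<Phi>_def algebra_simps)
    finally show ?thesis .
  qed
  have Phi_scale: "\<Phi> (s c x) = c * \<Phi> x" if "x \<in> W" for c x
  proof -
    have "s c x = s (of_real (re c)) x + s (of_real (im c)) (s w x)"
      by (subst decomp[of c]) (simp add: scale_left_distrib mult.commute)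
    then have "\<Phi> (s c x) = (of_real (re c) + w * of_real (im c)) * \<Phi> x"
      using that by (simp add: Phi_add Phi_real Phi_w mem algebra_simps del: scale_scale)
    then show ?thesis using decomp[of c] by simp
  qed
  have Phi_le: "norm (\<Phi> x) \<le> p x" if "x \<in> W" for x
  proof -
    obtain \<theta> where \<theta>: "norm \<theta> = 1" "\<theta> * \<Phi> x = of_real (norm (\<Phi> x))"
      by (rule unimodular_rotation)
    have "norm (\<Phi> x) = re (\<Phi> (s \<theta> x))"
      using that \<theta> by (simp add: Phi_scale re_of_real)
    also have "\<dots> \<le> p (s \<theta> x)"
      unfolding re_Phi using q(2) p'(2) mem[OF that] by (meson order_trans)
    finally show ?thesis using that \<theta> by (simp add: hom)
  qed
  \<comment> \<open>The real part of \<open>\<Phi> t\<close> is already \<open>p t\<close>, and its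
    norm is no larger, so that the imaginary part vanishes.\<close>
  have "\<Phi> t = of_real (p t)"
  proof -
    have "(p t)\<^sup>2 + (im (\<Phi> t))\<^sup>2 \<le> (p t)\<^sup>2"
      using norm_sq[of "\<Phi> t"] Phi_le[OF t] power_mono[OF Phi_le[OF t], of 2] by (simp add: re_Phi qt)
    then have "im (\<Phi> t) = 0" by simp
    then show ?thesis using decomp[of "\<Phi> t"] by (simp add: re_Phi qt)
  qed
  with Phi_add Phi_scale Phi_le show ?thesis using that by blast
qed

subsection \<open>Multi-indices and random signs\<close>

definition multi_indices :: "nat \<Rightarrow> nat \<Rightarrow> nat list set" where
  "multi_indices n k = {I. set I \<subseteq> {..<n} \<and> length I = k}"

lemma finite_multi_indices: "finite (multi_indices n k)"
  unfolding multi_indices_def by (rule finite_lists_length_eq) simp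

lemma nth_multi_indices: "I \<in> multi_indices n k \<Longrightarrow> j < k \<Longrightarrow> I ! j < n"
  unfolding multi_indices_def using nth_mem by fastforce

lemma length_multi_indices: "I \<in> multi_indices n k \<Longrightarrow> length I = k"
  unfolding multi_indices_def by simp

text \<open>The new index is appended at the end, so that the positions \<open>j < k\<close> keep
  their numbers and a product over \<open>{..<Suc k}\<close> splits off its last factor.\<close>

lemma sum_multi_indices_Suc:
  "(\<Sum>I\<in>multi_indices n (Suc k). g I) = (\<Sum>I\<in>multi_indices n k. \<Sum>i<n. g (I @ [i]))"
proof -
  have "bij_betw (\<lambda>(I, i). I @ [i]) (multi_indices n k \<times> {..<n}) (multi_indices n (Suc k))"
  proof (rule bij_betwI')
    fix I' assume I': "I' \<in> multi_indices n (Suc k)"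
    then have "I' \<noteq> []" by (auto simp: multi_indices_def)
    then have "I' = butlast I' @ [last I']" by simp
    moreover have "butlast I' \<in> multi_indices n k" "last I' < n"
      using I' \<open>I' \<noteq> []\<close> subsetD[OF _ last_in_set[of I'], of "{..<n}"]
      by (auto simp: multi_indices_def dest: in_set_butlastD)
    ultimately show "\<exists>x\<in>multi_indices n k \<times> {..<n}. I' = (case x of (I, i) \<Rightarrow> I @ [i])"
      by (intro bexI[of _ "(butlast I', last I')"]) auto
  qed (auto simp: multi_indices_def)
  from sum.reindex_bij_betw[OF this, of g] show ?thesis
    by (simp add: sum.cartesian_product case_prod_unfold)
qed

lemma sum_prod_multi_indices:
  fixes f :: "nat \<Rightarrow> nat \<Rightarrow> 'c::comm_semiring_1"
  shows "(\<Sum>I\<in>multi_indices n k. \<Prod>j<k. f j (I ! j)) = (\<Prod>j<k. \<Sum>i<n. f j i)"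
proof (induction k)
  case 0
  have "multi_indices n 0 = {[]}" by (auto simp: multi_indices_def)
  then show ?case by simp
next
  case (Suc k)
  have "(\<Sum>I\<in>multi_indices n (Suc k). \<Prod>j<Suc k. f j (I ! j)) =
      (\<Sum>I\<in>multi_indices n k. \<Sum>i<n. (\<Prod>j<k. f j (I ! j)) * f k i)"
    unfolding sum_multi_indices_Suc
    by (intro sum.cong refl) (simp add: length_multi_indices nth_append)
  also have "\<dots> = (\<Prod>j<k. \<Sum>i<n. f j i) * (\<Sum>i<n. f k i)"
    by (simp add: Suc.IH[symmetric] sum_product)
  finally show ?case by simp
qed

section \<open>Averages and moments of sign sums\<close>

definition signs :: "'i set \<Rightarrow> ('i \<Rightarrow> real) set" where
  "signs L = PiE L (\<lambda>_. {-1, 1})"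

lemma finite_signs: "finite L \<Longrightarrow> finite (signs L)"
  unfolding signs_def by (rule finite_PiE) auto

text \<open>Independence of the signs, with averages written as plain sums.\<close>

lemma sum_signs_prod:
  fixes f :: "'i \<Rightarrow> real \<Rightarrow> real"
  assumes "finite L"
  shows "(\<Sum>e\<in>signs L. \<Prod>i\<in>L. f i (e i)) = (\<Prod>i\<in>L. f i (- 1) + f i 1)"
  using prod_sum_PiE[OF assms, of "\<lambda>_. {-1, 1}" f] by (simp add: signs_def)

lemma card_signs: "finite L \<Longrightarrow> card (signs L) = 2 ^ card L"
  unfolding signs_def by (subst card_PiE) (auto simp: numeral_2_eq_2)

lemma sum_signs_mult:
  assumes L: "finite L" and "i \<in> L" "j \<in> L"
  shows "(\<Sum>e\<in>signs L. e i * e j) = (if i = j then 2 ^ card L else 0)"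
proof (cases "i = j")
  case True
  have "e i * e j = 1" if "e \<in> signs L" for e
    using that assms True PiE_mem[of e L "\<lambda>_. {-1, 1::real}" j] by (auto simp: signs_def)
  then show ?thesis using True card_signs[OF L] by simp
next
  case False
  \<comment> \<open>Padding with factors 1 gives the product form; the factor of the lone index
    \<open>i\<close> then sums to 0.\<close>
  have "e i * e j = (\<Prod>l\<in>L. if l = i \<or> l = j then e l else 1)" for e :: "_ \<Rightarrow> real"
  proof -
    have "(\<Prod>l\<in>L. if l = i \<or> l = j then e l else 1) = (\<Prod>l\<in>{i, j}. e l)"
      using assms by (intro prod.mono_neutral_cong_right) auto
    then show ?thesis using False by simp
  qed
  then have "(\<Sum>e\<in>signs L. e i * e j) = (\<Prod>l\<in>L. (if l = i \<or> l = j then -1 else 1) + (if l = i \<or> l = j then 1 else (1::real)))"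
    using sum_signs_prod[OF L, of "\<lambda>l x. if l = i \<or> l = j then x else 1"] by simp
  also have "\<dots> = 0"
    by (rule prod_zero[OF L]) (use assms in auto)
  finally show ?thesis using False by simp
qed

text \<open>On [0, 1] the two exponentials are at most \<open>1 + a + a\<^sup>2\<close> and
  \<open>1 - a + a\<^sup>2\<close>; the linear terms cancel, and
  \<open>1 + a\<^sup>2 \<le> exp (a\<^sup>2)\<close>.\<close>

lemma exp_plus_exp_minus_le:
  fixes a :: real
  assumes "\<bar>a\<bar> \<le> 1"
  shows "exp (- a) + exp a \<le> 2 * exp (a\<^sup>2)"
proof -
  have *: "exp (- a) + exp a \<le> 2 * exp (a\<^sup>2)" if a: "0 \<le> a" "a \<le> 1" for a :: real
  proof -
    have "exp a \<le> 1 + a + a\<^sup>2" using a by (rule exp_bound)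
    moreover have "exp (- a) \<le> 1 - a + a\<^sup>2"
    proof -
      \<comment> \<open>The product is \<open>1 + a ^ 3\<close>.\<close>
      have "1 \<le> (1 - a + a\<^sup>2) * (1 + a)"
        using a by (simp add: algebra_simps power2_eq_square)
      also have "\<dots> \<le> (1 - a + a\<^sup>2) * exp a"
        using a exp_ge_add_one_self[of a] by (intro mult_left_mono) (auto simp: power2_eq_square)
      finally show ?thesis by (simp add: exp_minus field_simps)
    qed
    ultimately show ?thesis using exp_ge_add_one_self[of "a\<^sup>2"] by linarith
  qed
  show ?thesis
    using *[of a] *[of "- a"] assms by (cases "a \<ge> 0") (auto simp: add.commute)
qed

text \<open>The exponential turns the sum into a product, which factors over the coordinates by
  independence. The normalization also puts each \<open>a i\<close> in [-1, 1], where the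
  one-coordinate estimate applies.\<close>

lemma sum_signs_exp_le:
  assumes L: "finite L" and a: "(\<Sum>i\<in>L. (a i)\<^sup>2) \<le> 1"
  shows "(\<Sum>e\<in>signs L. exp (\<Sum>i\<in>L. e i * a i)) \<le> 2 ^ card L * exp 1"
proof -
  have a1: "\<bar>a i\<bar> \<le> 1" if "i \<in> L" for i
  proof -
    have "(a i)\<^sup>2 \<le> (\<Sum>i\<in>L. (a i)\<^sup>2)"
      using that L by (intro member_le_sum) auto
    with a have "(a i)\<^sup>2 \<le> 1" by linarith
    then show ?thesis by (simp add: abs_square_le_1)
  qed
  have "(\<Sum>e\<in>signs L. exp (\<Sum>i\<in>L. e i * a i)) = (\<Prod>i\<in>L. exp (- a i) + exp (a i))"
    using sum_signs_prod[OF L, of "\<lambda>i x. exp (x * a i)"] by (simp add: exp_sum[OF L])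
  also have "\<dots> \<le> (\<Prod>i\<in>L. 2 * exp ((a i)\<^sup>2))"
    using a1 exp_plus_exp_minus_le by (intro prod_mono) (auto intro: add_nonneg_nonneg)
  also have "\<dots> = 2 ^ card L * exp (\<Sum>i\<in>L. (a i)\<^sup>2)"
    by (simp add: prod.distrib exp_sum[OF L])
  also have "\<dots> \<le> 2 ^ card L * exp 1"
    using a by simp
  finally show ?thesis .
qed

lemma power_le_fact_exp:
  fixes x :: real
  assumes "x \<ge> 0"
  shows "x ^ m \<le> fact m * exp x"
proof -
  have "sum (\<lambda>n. x ^ n /\<^sub>R fact n) {m} \<le> (\<Sum>n. x ^ n /\<^sub>R fact n)"
    using assms by (intro sum_le_suminf summable_exp_generic) auto
  then have "x ^ m / fact m \<le> exp x"
    by (simp add: exp_def divide_inverse mult.commute)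
  then show ?thesis by (simp add: field_simps)
qed

text \<open>Even moments are read off from exponential ones, at the price of
  \<open>fact (2 * k)\<close> instead of the Khintchine growth \<open>k ^ k\<close>; both are at
  most a polynomial in \<open>k\<close> raised to the power \<open>k\<close>.\<close>

lemma sum_signs_even_moment_le:
  assumes L: "finite L" and a: "(\<Sum>i\<in>L. (a i)\<^sup>2) \<le> 1"
  shows "(\<Sum>e\<in>signs L. (\<Sum>i\<in>L. e i * a i) ^ (2 * k)) \<le> 2 ^ card L * (2 * fact (2 * k) * exp 1)"
proof -
  have pw: "x ^ (2 * k) \<le> fact (2 * k) * (exp x + exp (- x))" for x :: real
  proof -
    have "x ^ (2 * k) = \<bar>x\<bar> ^ (2 * k)" by (simp add: power_mult)
    also have "\<dots> \<le> fact (2 * k) * exp \<bar>x\<bar>" by (rule power_le_fact_exp) simp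
    also have "\<dots> \<le> fact (2 * k) * (exp x + exp (- x))" by (intro mult_left_mono) (auto simp: abs_if)
    finally show ?thesis .
  qed
  have "(\<Sum>e\<in>signs L. (\<Sum>i\<in>L. e i * a i) ^ (2 * k)) \<le>
      (\<Sum>e\<in>signs L. fact (2 * k) * (exp (\<Sum>i\<in>L. e i * a i) + exp (- (\<Sum>i\<in>L. e i * a i))))"
    by (intro sum_mono pw)
  also have "\<dots> = fact (2 * k) * ((\<Sum>e\<in>signs L. exp (\<Sum>i\<in>L. e i * a i)) + (\<Sum>e\<in>signs L. exp (\<Sum>i\<in>L. e i * - a i)))"
    by (simp add: sum_distrib_left sum.distrib sum_negf distrib_left)
  also have "\<dots> \<le> fact (2 * k) * (2 ^ card L * exp 1 + 2 ^ card L * exp 1)"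
    using sum_signs_exp_le[OF L a] sum_signs_exp_le[OF L, of "\<lambda>i. - a i"] a
    by (intro mult_left_mono add_mono) auto
  finally show ?thesis by (simp add: algebra_simps)
qed

context scalars
begin

lemma sum_signs_norm_moment_le:
  fixes a :: "'i \<Rightarrow> 'k"
  assumes L: "finite L" and a: "(\<Sum>i\<in>L. (norm (a i))\<^sup>2) \<le> 1" and k: "k \<ge> 1"
  shows "(\<Sum>e\<in>signs L. norm (\<Sum>i\<in>L. of_real (e i) * a i) ^ (2 * k)) \<le> 2 ^ card L * (128 * real k ^ 2) ^ k"
proof -
  let ?x = "\<lambda>e. \<Sum>i\<in>L. e i * re (a i)" and ?y = "\<lambda>e. \<Sum>i\<in>L. e i * im (a i)"
  have pw: "(s + t) ^ k \<le> 2 ^ k * (s ^ k + t ^ k)" if "s \<ge> 0" "t \<ge> 0" for s t :: real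
  proof -
    have "(s + t) ^ k \<le> (2 * max s t) ^ k" using that by (intro power_mono) auto
    also have "\<dots> \<le> 2 ^ k * (s ^ k + t ^ k)"
      using that by (auto simp: power_mult_distrib max_def)
    finally show ?thesis .
  qed
  have "norm (\<Sum>i\<in>L. of_real (e i) * a i) ^ (2 * k) \<le> 2 ^ k * (?x e ^ (2 * k) + ?y e ^ (2 * k))" for e
    using pw[of "(?x e)\<^sup>2" "(?y e)\<^sup>2"]
    by (simp add: power_mult norm_sq re_sum im_sum re_of_real_mult im_of_real_mult)
  then have "(\<Sum>e\<in>signs L. norm (\<Sum>i\<in>L. of_real (e i) * a i) ^ (2 * k)) \<le>
      (\<Sum>e\<in>signs L. 2 ^ k * (?x e ^ (2 * k) + ?y e ^ (2 * k)))"
    by (intro sum_mono)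
  also have "\<dots> = 2 ^ k * ((\<Sum>e\<in>signs L. ?x e ^ (2 * k)) + (\<Sum>e\<in>signs L. ?y e ^ (2 * k)))"
    by (simp add: sum_distrib_left sum.distrib distrib_left)
  also have "\<dots> \<le> 2 ^ k * (2 ^ card L * (2 * fact (2 * k) * exp 1) + 2 ^ card L * (2 * fact (2 * k) * exp 1))"
  proof (intro mult_left_mono add_mono sum_signs_even_moment_le L)
    show "(\<Sum>i\<in>L. (re (a i))\<^sup>2) \<le> 1" "(\<Sum>i\<in>L. (im (a i))\<^sup>2) \<le> 1"
      using a sum_nonneg[of L "\<lambda>i. (re (a i))\<^sup>2"] sum_nonneg[of L "\<lambda>i. (im (a i))\<^sup>2"]
      by (auto simp: norm_sq sum.distrib)
  qed auto
  also have "\<dots> = 2 ^ card L * (4 * exp 1 * 2 ^ k * fact (2 * k))" by simp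
  \<comment> \<open>The constant 128 is \<open>16 * 2 * 4\<close>: 16 bounds
    \<open>4 * exp 1\<close>, 2 comes from separating real and imaginary part, and
    \<open>4 * k\<^sup>2\<close> from \<open>fact (2 * k) \<le> (2 * k) ^ (2 * k)\<close>.\<close>
  also have "\<dots> \<le> 2 ^ card L * (16 ^ k * 2 ^ k * (4 * real k ^ 2) ^ k)"
  proof (intro mult_left_mono mult_mono)
    have "4 * exp 1 \<le> (16::real)" using exp_le by simp
    also have "\<dots> \<le> 16 ^ k" using k by (simp add: self_le_power)
    finally show "4 * exp 1 \<le> (16::real) ^ k" .
    have "(fact (2 * k) :: real) \<le> real (2 * k) ^ (2 * k)"
      using fact_le_power[of "2 * k", where ?'a = real] by (simp only: of_nat_power)
    also have "\<dots> = ((real (2 * k))\<^sup>2) ^ k" by (rule power_mult)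
    also have "(real (2 * k))\<^sup>2 = 4 * real k ^ 2" by (simp add: power2_eq_square)
    finally show "(fact (2 * k) :: real) \<le> (4 * real k ^ 2) ^ k" .
  qed auto
  also have "16 ^ k * 2 ^ k * (4 * real k ^ 2) ^ k = (16 * 2 * (4 * real k ^ 2)) ^ k"
    by (simp only: power_mult_distrib)
  finally show ?thesis by simp
qed

subsection \<open>A finite net in the Euclidean ball\<close>

lemma Cauchy_Schwarz_norm:
  fixes a b :: "'i \<Rightarrow> 'k"
  shows "norm (\<Sum>i\<in>A. a i * b i) \<le> sqrt (\<Sum>i\<in>A. (norm (a i))\<^sup>2) * sqrt (\<Sum>i\<in>A. (norm (b i))\<^sup>2)"
proof -
  have "norm (\<Sum>i\<in>A. a i * b i) \<le> (\<Sum>i\<in>A. norm (a i) * norm (b i))"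
    by (rule order_trans[OF norm_sum]) (simp add: norm_mult)
  also have "\<dots> \<le> sqrt ((\<Sum>i\<in>A. (norm (a i))\<^sup>2) * (\<Sum>i\<in>A. (norm (b i))\<^sup>2))"
    by (intro real_le_rsqrt Cauchy_Schwarz_ineq_sum)
  finally show ?thesis by (simp add: real_sqrt_mult)
qed

text \<open>For every \<open>u\<close> the net has to contain an almost optimal functional. It is
  obtained by rounding the coordinates of the optimal one, \<open>cj (u i)\<close> divided by the
  Euclidean norm of \<open>u\<close>, to a finite grid.\<close>

lemma finite_norming_net:
  assumes "\<delta> > 0"
  shows "\<exists>N :: (nat \<Rightarrow> 'k) set. finite N \<and> (\<forall>a\<in>N. (\<Sum>i<n. (norm (a i))\<^sup>2) \<le> 1) \<and>
    (\<forall>u :: nat \<Rightarrow> 'k. \<exists>a\<in>N. (1 - \<delta>) * sqrt (\<Sum>i<n. (norm (u i))\<^sup>2) \<le> norm (\<Sum>i<n. a i * u i))"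
proof -
  \<comment> \<open>Rounding to mesh \<open>1 / M\<close> changes a coordinate by at most
    \<open>2 / M\<close>, hence the pairing with \<open>u\<close> by at most
    \<open>2 * n / M\<close> times the norm of \<open>u\<close>.\<close>
  obtain M :: nat where M: "2 * real n / \<delta> < real M"
    using reals_Archimedean2 by blast
  moreover have "2 * real n / \<delta> \<ge> 0" using assms by simp
  ultimately have M0: "M > 0" by linarith
  have nM: "2 * real n / real M \<le> \<delta>"
    using M M0 assms by (simp add: field_simps)
  \<comment> \<open>Rounding is towards 0, so that rounded vectors stay in the unit ball.\<close>
  define trunc :: "real \<Rightarrow> real" where "trunc t = sgn t * of_int \<lfloor>\<bar>t\<bar> * M\<rfloor> / M" for t
  have trunc: "\<bar>trunc t\<bar> \<le> \<bar>t\<bar>" "\<bar>t - trunc t\<bar> \<le> 1 / M" for t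
  proof -
    have fl: "of_int \<lfloor>\<bar>t\<bar> * M\<rfloor> \<le> \<bar>t\<bar> * M" "\<bar>t\<bar> * M < of_int \<lfloor>\<bar>t\<bar> * M\<rfloor> + 1"
      by linarith+
    define F where "F = of_int \<lfloor>\<bar>t\<bar> * M\<rfloor> / real M"
    have F: "0 \<le> F" "F \<le> \<bar>t\<bar>" "\<bar>t\<bar> < F + 1 / M"
      using fl M0 by (simp_all add: F_def field_simps)
    have "trunc t = sgn t * F" by (simp add: trunc_def F_def)
    with F show "\<bar>trunc t\<bar> \<le> \<bar>t\<bar>" "\<bar>t - trunc t\<bar> \<le> 1 / M"
      by (auto simp: sgn_if abs_if split: if_splits)
  qed
  define grid :: "real set" where "grid = (\<lambda>z. of_int z / M) ` {- int M..int M}"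
  have trunc_grid: "trunc t \<in> grid" if "\<bar>t\<bar> \<le> 1" for t
  proof -
    define F where "F = \<lfloor>\<bar>t\<bar> * M\<rfloor>"
    define z where "z = (if t > 0 then F else if t = 0 then 0 else - F)"
    have "\<bar>t\<bar> * M \<le> real M" using that M0 by (simp add: mult_le_cancel_right2)
    then have "F \<le> int M" unfolding F_def by linarith
    moreover have "0 \<le> F" by (simp add: F_def)
    ultimately have "z \<in> {- int M..int M}" by (auto simp: z_def)
    moreover have "trunc t = of_int z / M" by (auto simp: trunc_def z_def F_def sgn_if)
    ultimately show ?thesis unfolding grid_def by blast
  qed
  have fin_grid: "finite grid" unfolding grid_def by simp
  define G where "G = (\<lambda>(x, y). of_real x + w * of_real y :: 'k) ` (grid \<times> grid)"
  have fin_G: "finite G" unfolding G_def using fin_grid by simp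
  have G_mem: "of_real x + w * of_real y \<in> G" if "x \<in> grid" "y \<in> grid" for x y
    unfolding G_def using that by (intro image_eqI[of _ _ "(x, y)"]) auto
  define N where "N = {a \<in> PiE {..<n} (\<lambda>_. G). (\<Sum>i<n. (norm (a i))\<^sup>2) \<le> 1}"
  have net: "\<exists>a\<in>N. (1 - \<delta>) * sqrt (\<Sum>i<n. (norm (u i))\<^sup>2) \<le> norm (\<Sum>i<n. a i * u i)" for u :: "nat \<Rightarrow> 'k"
  proof -
    define U where "U = sqrt (\<Sum>i<n. (norm (u i))\<^sup>2)"
    have U2: "U\<^sup>2 = (\<Sum>i<n. (norm (u i))\<^sup>2)"
      unfolding U_def by (simp add: sum_nonneg)
    have U0: "U \<ge> 0" unfolding U_def by (simp add: sum_nonneg)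
    \<comment> \<open>For \<open>U = 0\<close> the division yields \<open>v = 0\<close>, for which
      all claims below hold.\<close>
    define v where "v i = cj (u i) / of_real U" for i
    have nv: "norm (v i) = norm (u i) / U" for i
      using U0 by (simp add: v_def norm_divide norm_cj)
    have uU: "norm (u i) \<le> U" if "i < n" for i
    proof -
      have "(norm (u i))\<^sup>2 \<le> U\<^sup>2"
        unfolding U2 using that by (intro member_le_sum) auto
      then show ?thesis using U0 by (rule power2_le_imp_le)
    qed
    have nv1: "norm (v i) \<le> 1" if "i < n" for i
      using uU[OF that] U0 by (cases "U = 0") (simp_all add: nv divide_le_eq_1)
    define a where "a = (\<lambda>i\<in>{..<n}. of_real (trunc (re (v i))) + w * of_real (trunc (im (v i))))"
    have na: "(norm (a i))\<^sup>2 \<le> (norm (v i))\<^sup>2" if "i < n" for i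
    proof -
      \<comment> \<open>Here \<open>norm_sq_le\<close> is an inequality because over the reals,
        where \<open>w = 0\<close>, the second summand is lost.\<close>
      have "(norm (a i))\<^sup>2 \<le> (trunc (re (v i)))\<^sup>2 + (trunc (im (v i)))\<^sup>2"
        using that norm_sq_le by (simp add: a_def)
      also have "\<dots> \<le> (re (v i))\<^sup>2 + (im (v i))\<^sup>2"
        using trunc by (intro add_mono) (auto simp: abs_le_square_iff)
      finally show ?thesis by (simp add: norm_sq)
    qed
    have va: "norm (v i - a i) \<le> 2 / M" if "i < n" for i
    proof -
      have "v i - a i = of_real (re (v i) - trunc (re (v i))) + w * of_real (im (v i) - trunc (im (v i)))"
        by (subst decomp[of "v i"]) (use that in \<open>simp add: a_def right_diff_distrib\<close>)
      also have "norm \<dots> \<le> \<bar>re (v i) - trunc (re (v i))\<bar> + norm w * \<bar>im (v i) - trunc (im (v i))\<bar>"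
        by (rule order_trans[OF norm_triangle_ineq]) (simp add: norm_mult del: of_real_diff)
      also have "\<dots> \<le> 1 / M + 1 * (1 / M)"
        by (intro add_mono mult_mono trunc norm_w_le) auto
      finally show ?thesis by simp
    qed
    have "(\<Sum>i<n. (norm (v i))\<^sup>2) \<le> 1"
      using U0 by (simp add: nv power_divide U2[symmetric] flip: sum_divide_distrib)
    moreover have "(\<Sum>i<n. (norm (a i))\<^sup>2) \<le> (\<Sum>i<n. (norm (v i))\<^sup>2)"
      by (intro sum_mono na) auto
    moreover have "a \<in> PiE {..<n} (\<lambda>_. G)"
    proof -
      have "\<bar>re (v i)\<bar> \<le> 1" "\<bar>im (v i)\<bar> \<le> 1" if "i < n" for i
        using nv1[OF that] abs_re_le[of "v i"] abs_im_le[of "v i"] by linarith+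
      then show ?thesis by (auto simp: a_def intro!: G_mem trunc_grid)
    qed
    ultimately have "a \<in> N" unfolding N_def by simp
    moreover have "(1 - \<delta>) * U \<le> norm (\<Sum>i<n. a i * u i)"
    proof -
      have "(\<Sum>i<n. v i * u i) = of_real U"
      proof (cases "U = 0")
        case False
        have "(\<Sum>i<n. v i * u i) = of_real (\<Sum>i<n. (norm (u i))\<^sup>2) / of_real U"
          using mult_cj by (simp add: v_def sum_divide_distrib mult.commute)
        also have "\<dots> = of_real U"
          unfolding U2[symmetric] using False by (simp add: power2_eq_square)
        finally show ?thesis .
      qed (simp add: v_def)
      then have "U = norm ((\<Sum>i<n. a i * u i) + (\<Sum>i<n. (v i - a i) * u i))"
        using U0 by (simp add: left_diff_distrib sum_subtractf)
      also have "\<dots> \<le> norm (\<Sum>i<n. a i * u i) + (\<Sum>i<n. norm (v i - a i) * norm (u i))"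
        by (intro order_trans[OF norm_triangle_ineq] add_left_mono sum_norm_le) (simp add: norm_mult)
      also have "(\<Sum>i<n. norm (v i - a i) * norm (u i)) \<le> (\<Sum>i<n. 2 / M * U)"
        by (intro sum_mono mult_mono va uU) auto
      also have "\<dots> = 2 * real n / M * U" by simp
      also have "\<dots> \<le> \<delta> * U" by (intro mult_right_mono nM U0)
      finally show ?thesis by (simp add: algebra_simps)
    qed
    ultimately show ?thesis by (intro bexI[of _ a]) (simp_all add: U_def)
  qed
  have "N \<subseteq> PiE {..<n} (\<lambda>_. G)" unfolding N_def by blast
  then have fin_N: "finite N"
    by (rule finite_subset) (intro finite_PiE fin_G finite_lessThan)
  have ball: "\<forall>a\<in>N. (\<Sum>i<n. (norm (a i))\<^sup>2) \<le> 1" unfolding N_def by blast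
  show ?thesis
    by (rule exI[of _ N], intro conjI fin_N ball allI net)
qed

subsection \<open>Multilinear forms with random sign coefficients\<close>

definition sign_form :: "nat \<Rightarrow> nat \<Rightarrow> (nat list \<Rightarrow> real) \<Rightarrow> (nat \<Rightarrow> nat \<Rightarrow> 'k) \<Rightarrow> 'k" where
  "sign_form n k e a = (\<Sum>I\<in>multi_indices n k. of_real (e I) * (\<Prod>j<k. a j (I ! j)))"

lemma sign_form_cong:
  assumes "\<And>j i. j < k \<Longrightarrow> i < n \<Longrightarrow> a j i = b j i"
  shows "sign_form n k e a = sign_form n k e b"
  unfolding sign_form_def
  by (intro sum.cong refl arg_cong2[of _ _ _ _ "(*)"] prod.cong assms) (auto intro: nth_multi_indices)

text \<open>With all other slots fixed the form is the pairing with a coefficient vector, the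
  \<open>u\<close> to which the net property is applied.\<close>

lemma sign_form_expand_slot:
  assumes r: "r < k"
  shows "sign_form n k e (a(r := b)) = (\<Sum>i<n. b i * sign_form n k e (a(r := (\<lambda>l. if l = i then 1 else 0))))"
proof -
  have slot: "(\<Prod>j<k. (a(r := c)) j (I ! j)) = c (I ! r) * (\<Prod>j\<in>{..<k} - {r}. a j (I ! j))"
    for c :: "nat \<Rightarrow> 'k" and I
    using r by (subst prod.remove[of _ r]) (auto intro!: prod.cong)
  have "(\<Sum>i<n. b i * sign_form n k e (a(r := (\<lambda>l. if l = i then 1 else 0)))) =
      (\<Sum>i<n. \<Sum>I\<in>multi_indices n k. (if I ! r = i then b i else 0) * (of_real (e I) * (\<Prod>j\<in>{..<k} - {r}. a j (I ! j))))"
    unfolding sign_form_def slot sum_distrib_left by (intro sum.cong refl) auto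
  also have "\<dots> = (\<Sum>I\<in>multi_indices n k. (\<Sum>i<n. if I ! r = i then b i else 0) * (of_real (e I) * (\<Prod>j\<in>{..<k} - {r}. a j (I ! j))))"
    by (subst sum.swap) (simp only: sum_distrib_right)
  also have "\<dots> = sign_form n k e (a(r := b))"
    unfolding sign_form_def slot
    using nth_multi_indices[OF _ r, of _ n] by (intro sum.cong refl) (simp add: mult_ac)
  finally show ?thesis by simp
qed

text \<open>The slots are moved into the net one at a time. With the others fixed, the form is a
  linear functional of one slot, and the net nearly attains its Euclidean norm, so that each move
  costs a factor \<open>1 - \<delta>\<close>.\<close>

lemma sign_form_le_of_net:
  assumes net: "\<And>u :: nat \<Rightarrow> 'k. \<exists>a\<in>N. (1 - \<delta>) * sqrt (\<Sum>i<n. (norm (u i))\<^sup>2) \<le> norm (\<Sum>i<n. a i * u i)"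
    and \<delta>: "\<delta> < 1"
    and G: "\<And>a. (\<And>j. j < k \<Longrightarrow> a j \<in> N) \<Longrightarrow> norm (sign_form n k e a) \<le> G"
    and a: "\<And>j. j < k \<Longrightarrow> (\<Sum>i<n. (norm (a j i))\<^sup>2) \<le> 1"
  shows "(1 - \<delta>) ^ k * norm (sign_form n k e a) \<le> G"
proof -
  \<comment> \<open>\<open>r\<close> counts the slots that are still arbitrary; the slots from
    \<open>r\<close> on already lie in \<open>N\<close>.\<close>
  have "(1 - \<delta>) ^ r * norm (sign_form n k e a) \<le> G"
    if "r \<le> k" "\<And>j. j < r \<Longrightarrow> (\<Sum>i<n. (norm (a j i))\<^sup>2) \<le> 1" "\<And>j. r \<le> j \<Longrightarrow> j < k \<Longrightarrow> a j \<in> N" for r a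
    using that
  proof (induction r arbitrary: a)
    case 0
    then show ?case using G[of a] by simp
  next
    case (Suc r)
    then have r: "r < k" by simp
    define u where "u i = sign_form n k e (a(r := (\<lambda>l. if l = i then 1 else 0)))" for i
    obtain b where b: "b \<in> N" "(1 - \<delta>) * sqrt (\<Sum>i<n. (norm (u i))\<^sup>2) \<le> norm (\<Sum>i<n. b i * u i)"
      using net by blast
    have "norm (sign_form n k e a) = norm (\<Sum>i<n. a r i * u i)"
      using sign_form_expand_slot[OF r, of n e a "a r"] by (simp add: u_def)
    also have "\<dots> \<le> sqrt (\<Sum>i<n. (norm (a r i))\<^sup>2) * sqrt (\<Sum>i<n. (norm (u i))\<^sup>2)"
      by (rule Cauchy_Schwarz_norm)
    also have "\<dots> \<le> 1 * sqrt (\<Sum>i<n. (norm (u i))\<^sup>2)"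
      using Suc.prems(2)[of r] by (intro mult_right_mono) (auto simp: sum_nonneg)
    finally have "(1 - \<delta>) * norm (sign_form n k e a) \<le> (1 - \<delta>) * sqrt (\<Sum>i<n. (norm (u i))\<^sup>2)"
      using \<delta> by simp
    also have "\<dots> \<le> norm (sign_form n k e (a(r := b)))"
      using b(2) sign_form_expand_slot[OF r, of n e a b] by (simp add: u_def)
    finally have "(1 - \<delta>) ^ Suc r * norm (sign_form n k e a) \<le> (1 - \<delta>) ^ r * norm (sign_form n k e (a(r := b)))"
      using \<delta> by (simp add: mult_left_mono mult_ac)
    also have "\<dots> \<le> G"
      using Suc.prems b(1) by (intro Suc.IH) (auto simp: less_Suc_eq)
    finally show ?case .
  qed
  from this[of k a] show ?thesis using a by auto
qed

text \<open>The square sum of the coefficients factors into the product of the squared norms of the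
  \<open>a j\<close>, so that the scalar moment bound applies.\<close>

lemma sum_signs_sign_form_moment_le:
  assumes k: "k \<ge> 1" and a: "\<And>j. j < k \<Longrightarrow> (\<Sum>i<n. (norm (a j i))\<^sup>2) \<le> 1"
  shows "(\<Sum>e\<in>signs (multi_indices n k). norm (sign_form n k e a) ^ (2 * k)) \<le>
    2 ^ card (multi_indices n k) * (128 * real k ^ 2) ^ k"
  unfolding sign_form_def
proof (rule sum_signs_norm_moment_le[OF finite_multi_indices _ k])
  have "(\<Sum>I\<in>multi_indices n k. (norm (\<Prod>j<k. a j (I ! j)))\<^sup>2) =
      (\<Sum>I\<in>multi_indices n k. \<Prod>j<k. (norm (a j (I ! j)))\<^sup>2)"
    by (simp only: prod_norm[symmetric] prod_power_distrib)
  also have "\<dots> = (\<Prod>j<k. \<Sum>i<n. (norm (a j i))\<^sup>2)"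
    by (rule sum_prod_multi_indices)
  also have "\<dots> \<le> 1"
    using a by (intro prod_le_1) (auto simp: sum_nonneg)
  finally show "(\<Sum>I\<in>multi_indices n k. (norm (\<Prod>j<k. a j (I ! j)))\<^sup>2) \<le> 1" .
qed

text \<open>
  The average over the signs of the quadratic form \<open>\<Sum> e\<^sub>I e\<^sub>J Q\<^sub>I\<^sub>J\<close> is its trace, while the average of
  \<open>M\<^sup>2\<close>, for \<open>M\<close> the supremum of the sign form, grows polynomially in \<open>k\<close> up to the loss from the net.
  The supremum over the net is controlled by the \<open>2k\<close>-th moment \<open>R\<close>, using \<open>x \<le> 1 + x\<^sup>k\<close>.
\<close>

lemma exists_signs_large_quadratic_form:
  assumes \<delta>: "0 < \<delta>" "\<delta> < 1"
  shows "\<exists>K>0. \<forall>k Q c. k \<ge> 1 \<longrightarrow> c = (\<Sum>I\<in>multi_indices n k. Q I I) \<longrightarrow> c \<ge> 0 \<longrightarrow>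
      (\<exists>e. \<exists>M>0. (\<forall>a. (\<forall>j<k. (\<Sum>i<n. (norm (a j i))\<^sup>2) \<le> 1) \<longrightarrow> norm (sign_form n k e a) \<le> M) \<and>
        c * M\<^sup>2 * (1 - \<delta>) ^ (2 * k) \<le>
          K * (real k)\<^sup>2 * (\<Sum>I\<in>multi_indices n k. \<Sum>J\<in>multi_indices n k. e I * e J * Q I J))"
proof -
  obtain N :: "(nat \<Rightarrow> 'k) set" where N: "finite N"
    "\<And>a. a \<in> N \<Longrightarrow> (\<Sum>i<n. (norm (a i))\<^sup>2) \<le> 1"
    "\<And>u :: nat \<Rightarrow> 'k. \<exists>a\<in>N. (1 - \<delta>) * sqrt (\<Sum>i<n. (norm (u i))\<^sup>2) \<le> norm (\<Sum>i<n. a i * u i)"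
    using finite_norming_net[OF \<delta>(1), of n] by blast
  have "card N > 0" using N(1,3) by (auto simp: card_gt_0_iff)
  \<comment> \<open>Twice the constant in \<open>v\<close> below, the 2 bounding the mean of
    \<open>1 + R e / v ^ k\<close>. It depends on \<open>n\<close> and \<open>\<delta>\<close> but
    not on \<open>k\<close>.\<close>
  define K where "K = 256 * real (card N)"
  have "K > 0" using \<open>card N > 0\<close> by (simp add: K_def)
  have "\<exists>e. \<exists>M>0. (\<forall>a. (\<forall>j<k. (\<Sum>i<n. (norm (a j i))\<^sup>2) \<le> 1) \<longrightarrow> norm (sign_form n k e a) \<le> M) \<and>
        c * M\<^sup>2 * (1 - \<delta>) ^ (2 * k) \<le>
          K * (real k)\<^sup>2 * (\<Sum>I\<in>multi_indices n k. \<Sum>J\<in>multi_indices n k. e I * e J * Q I J)"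
    if k: "k \<ge> 1" and c: "c = (\<Sum>I\<in>multi_indices n k. Q I I)" "c \<ge> 0" for k c and Q :: "nat list \<Rightarrow> nat list \<Rightarrow> real"
  proof -
    let ?L = "multi_indices n k" and ?E = "signs (multi_indices n k)"
    \<comment> \<open>\<open>v ^ k\<close> is the moment bound times \<open>card N ^ k\<close>, the
      number of points of the product net; it bounds the mean of \<open>R\<close>.\<close>
    define v where "v = real (card N) * (128 * real k ^ 2)"
    have v0: "v > 0" using \<open>card N > 0\<close> k by (simp add: v_def)
    let ?NN = "PiE {..<k} (\<lambda>_. N)"
    have fin_NN: "finite ?NN" using N(1) by (auto intro: finite_PiE)
    define R where "R e = (\<Sum>a\<in>?NN. norm (sign_form n k e a) ^ (2 * k))" for e
    define q where "q e = (\<Sum>I\<in>?L. \<Sum>J\<in>?L. e I * e J * Q I J)" for e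
    have R0: "R e \<ge> 0" for e unfolding R_def by (intro sum_nonneg) simp
    have sumR: "(\<Sum>e\<in>?E. R e) \<le> 2 ^ card ?L * v ^ k"
    proof -
      have "(\<Sum>e\<in>?E. R e) = (\<Sum>a\<in>?NN. \<Sum>e\<in>?E. norm (sign_form n k e a) ^ (2 * k))"
        unfolding R_def by (rule sum.swap)
      also have "\<dots> \<le> (\<Sum>a\<in>?NN. 2 ^ card ?L * (128 * real k ^ 2) ^ k)"
        using N(2) by (intro sum_mono sum_signs_sign_form_moment_le[OF k]) (auto simp: PiE_iff)
      also have "\<dots> = 2 ^ card ?L * v ^ k"
        by (simp add: card_PiE v_def power_mult_distrib)
      finally show ?thesis .
    qed
    have sumq: "(\<Sum>e\<in>?E. q e) = 2 ^ card ?L * c"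
    proof -
      have "(\<Sum>e\<in>?E. q e) = (\<Sum>I\<in>?L. \<Sum>J\<in>?L. \<Sum>e\<in>?E. e I * e J * Q I J)"
        unfolding q_def by (subst sum.swap, intro sum.cong refl, rule sum.swap)
      also have "\<dots> = (\<Sum>I\<in>?L. \<Sum>J\<in>?L. (if I = J then 2 ^ card ?L else 0) * Q I J)"
        by (intro sum.cong refl)
          (simp add: sum_signs_mult[OF finite_multi_indices, symmetric] sum_distrib_right)
      also have "\<dots> = (\<Sum>I\<in>?L. \<Sum>J\<in>?L. if I = J then 2 ^ card ?L * Q I I else 0)"
        by (intro sum.cong refl) auto
      also have "\<dots> = 2 ^ card ?L * c"
        by (simp add: c finite_multi_indices sum_distrib_left)
      finally show ?thesis .
    qed
    \<comment> \<open>Summed over all signs, the left side is at most \<open>2 * v * c\<close> times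
      the number of sign patterns and the right side equals it, so the inequality holds for some
      \<open>e\<close>. It makes \<open>q e\<close> large relative to the supremum of this very sign
      form.\<close>
    have "\<exists>e\<in>?E. c * v * (1 + R e / v ^ k) \<le> 2 * v * q e"
    proof (rule ccontr)
      assume "\<not> ?thesis"
      then have lt: "2 * v * q e < c * v * (1 + R e / v ^ k)" if "e \<in> ?E" for e
        using that by auto
      have "card ?E \<noteq> 0" by (simp add: card_signs finite_multi_indices)
      then have "?E \<noteq> {}" by auto
      then have "(\<Sum>e\<in>?E. 2 * v * q e) < (\<Sum>e\<in>?E. c * v * (1 + R e / v ^ k))"
        by (intro sum_strict_mono lt finite_signs finite_multi_indices)
      also have "\<dots> = c * v * (2 ^ card ?L + (\<Sum>e\<in>?E. R e) / v ^ k)"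
        by (simp add: sum.distrib card_signs finite_multi_indices flip: sum_distrib_left sum_divide_distrib)
      also have "\<dots> \<le> c * v * (2 ^ card ?L + 2 ^ card ?L)"
        using sumR c(2) v0 by (intro mult_left_mono add_left_mono) (auto simp: field_simps)
      also have "\<dots> = 2 * v * (\<Sum>e\<in>?E. q e)" by (simp add: sumq)
      finally show False by (simp add: sum_distrib_left)
    qed
    then obtain e where e: "c * v * (1 + R e / v ^ k) \<le> 2 * v * q e" by blast
    define G where "G = sqrt (v * (1 + R e / v ^ k))"
    have G2: "G\<^sup>2 = v * (1 + R e / v ^ k)" and G0: "G > 0"
      using v0 R0[of e] by (auto simp: G_def intro!: mult_pos_pos add_pos_nonneg)
    have net: "norm (sign_form n k e a) \<le> G" if a: "\<And>j. j < k \<Longrightarrow> a j \<in> N" for a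
    proof -
      let ?x = "norm (sign_form n k e a)"
      have "sign_form n k e a = sign_form n k e (restrict a {..<k})"
        by (rule sign_form_cong) simp
      moreover have "restrict a {..<k} \<in> ?NN" using a by auto
      ultimately have xR: "?x ^ (2 * k) \<le> R e"
        unfolding R_def using fin_NN by (auto intro!: member_le_sum)
      have "?x\<^sup>2 / v \<le> 1 + R e / v ^ k"
      proof (cases "?x\<^sup>2 / v \<le> 1")
        case True
        then show ?thesis using R0[of e] v0 by (simp add: add_increasing2)
      next
        case False
        then have "?x\<^sup>2 / v \<le> (?x\<^sup>2 / v) ^ k" using k by (intro self_le_power) auto
        also have "\<dots> \<le> R e / v ^ k"
          using xR v0 by (simp add: power_divide divide_right_mono flip: power_mult)
        finally show ?thesis by simp
      qed
      then have "?x\<^sup>2 \<le> G\<^sup>2" using v0 by (simp add: G2 field_simps)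
      then show ?thesis using G0 by (meson less_imp_le power2_le_imp_le)
    qed
    define M where "M = G / (1 - \<delta>) ^ k"
    have "M > 0" using G0 \<delta> by (simp add: M_def)
    moreover have "norm (sign_form n k e a) \<le> M" if "\<forall>j<k. (\<Sum>i<n. (norm (a j i))\<^sup>2) \<le> 1" for a
      using sign_form_le_of_net[OF N(3) \<delta>(2) net, of a] that \<delta> by (simp add: M_def field_simps)
    moreover have "c * M\<^sup>2 * (1 - \<delta>) ^ (2 * k) \<le> K * (real k)\<^sup>2 * q e"
    proof -
      have "M\<^sup>2 * (1 - \<delta>) ^ (2 * k) = G\<^sup>2"
        using \<delta> by (simp add: M_def power_divide power_mult[symmetric] mult.commute)
      then have "c * M\<^sup>2 * (1 - \<delta>) ^ (2 * k) = c * v * (1 + R e / v ^ k)"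
        by (simp add: G2 mult.assoc)
      also have "\<dots> \<le> 2 * v * q e" by (rule e)
      also have "\<dots> = K * (real k)\<^sup>2 * q e" by (simp add: K_def v_def)
      finally show ?thesis .
    qed
    ultimately show ?thesis
      unfolding q_def by (intro exI[of _ e]) auto
  qed
  then show ?thesis
    by (intro exI[of _ K] conjI \<open>K > 0\<close>) simp
qed

end

subsection \<open>Bases, functionals and the dual norm\<close>

lemma vector_space_mult: "vector_space ((*) :: 'k::field \<Rightarrow> 'k \<Rightarrow> 'k)"
  by unfold_locales (simp_all add: algebra_simps)

locale scalar_normed_space = scalars cj re im w + fin_dim_normed_space scale nrm
  for cj :: "'k::real_normed_field \<Rightarrow> 'k" and re im :: "'k \<Rightarrow> real" and w :: 'k
    and scale :: "'k \<Rightarrow> 'a::ab_group_add \<Rightarrow> 'a" and nrm :: "'a \<Rightarrow> real"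
begin

lemma nrm_0 [simp]: "nrm 0 = 0"
  using nrm_eq_0_iff by simp

lemma nrm_minus: "nrm (- x) = nrm x"
  using nrm_scale[of "- 1" x] by simp

lemma nrm_ge_0 [simp]: "nrm x \<ge> 0"
  using nrm_triangle[of x "- x"] by (simp add: nrm_minus)

lemma dual_space_iff:
  "f \<in> dual_space scale \<longleftrightarrow> (\<forall>x y. f (x + y) = f x + f y) \<and> (\<forall>c x. f (scale c x) = c * f x)"
  using vector_space_axioms vector_space_mult
  by (auto simp: dual_space_def Vector_Spaces.linear_iff)

lemma dual_add: "f \<in> dual_space scale \<Longrightarrow> f (x + y) = f x + f y"
  and dual_scale: "f \<in> dual_space scale \<Longrightarrow> f (scale c x) = c * f x"
  by (auto simp: dual_space_iff)

lemma dual_0: "f \<in> dual_space scale \<Longrightarrow> f 0 = 0"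
  using dual_scale[of f 0 0] by simp

lemma dual_diff: "f \<in> dual_space scale \<Longrightarrow> f (x - y) = f x - f y"
  using dual_add[of f "x - y" y] by (simp add: algebra_simps)

lemma dual_sum: "f \<in> dual_space scale \<Longrightarrow> f (\<Sum>i\<in>I. x i) = (\<Sum>i\<in>I. f (x i))"
  by (induction I rule: infinite_finite_induct) (auto simp: dual_add dual_0)

lemma dual_space_zero: "(\<lambda>_. 0) \<in> dual_space scale"
  by (simp add: dual_space_iff)

lemma dual_space_lincomb:
  assumes "\<And>i. i \<in> I \<Longrightarrow> f i \<in> dual_space scale"
  shows "(\<lambda>x. \<Sum>i\<in>I. a i * f i x) \<in> dual_space scale"
  using assms by (simp add: dual_space_iff sum.distrib distrib_left sum_distrib_left mult_ac)

text \<open>Guarantees that a longest biorthogonal system exists.\<close>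

lemma biorthogonal_card_le:
  assumes B: "finite B" "span B = UNIV"
    and f: "\<And>i. i < n \<Longrightarrow> f i \<in> dual_space scale"
    and biorth: "\<And>i j. i < n \<Longrightarrow> j < n \<Longrightarrow> f i (x j) = (if i = j then 1 else 0)"
  shows "n \<le> card B"
proof -
  have inj: "inj_on x {..<n}"
    using biorth by (intro inj_onI) (metis lessThan_iff zero_neq_one)
  have "independent (x ` {..<n})"
  proof (rule independent_if_scalars_zero)
    fix u v assume u: "(\<Sum>v\<in>x ` {..<n}. scale (u v) v) = 0" and "v \<in> x ` {..<n}"
    then obtain i where i: "i < n" "v = x i" by auto
    have "0 = f i (\<Sum>v\<in>x ` {..<n}. scale (u v) v)"
      by (simp add: u dual_0 f i)
    also have "\<dots> = (\<Sum>j<n. u (x j) * f i (x j))"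
      by (simp add: sum.reindex[OF inj] dual_sum dual_scale f i)
    also have "\<dots> = (\<Sum>j<n. if j = i then u (x j) else 0)"
      by (intro sum.cong refl) (use biorth i in auto)
    finally show "u v = 0" using i by simp
  qed simp
  then have "card (x ` {..<n}) \<le> card B"
    using independent_span_bound[of B] B by auto
  then show ?thesis by (simp add: card_image[OF inj])
qed

text \<open>A longest biorthogonal system is complete: the residual of an unexpanded
  \<open>v\<close> is killed by all \<open>f i\<close>, and \<open>ext\<close> would lengthen the
  system. The relation \<open>R\<close> carries what new pairs have to satisfy, boundedness in one
  application and orthonormality in the other.\<close>

lemma complete_biorthogonal_system:
  fixes R :: "'a \<Rightarrow> ('a \<Rightarrow> 'k) \<Rightarrow> bool"
  assumes dual: "\<And>x f. R x f \<Longrightarrow> f \<in> dual_space scale"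
    and ext: "\<And>(n::nat) x f v. \<lbrakk>\<And>i. i < n \<Longrightarrow> R (x i) (f i);
        \<And>i j. i < n \<Longrightarrow> j < n \<Longrightarrow> f i (x j) = (if i = j then 1 else 0);
        v \<noteq> 0; \<And>i. i < n \<Longrightarrow> f i v = 0\<rbrakk> \<Longrightarrow>
      \<exists>y g. R y g \<and> g y = 1 \<and> (\<forall>i<n. g (x i) = 0 \<and> f i y = 0)"
  shows "\<exists>(n::nat) x f. (\<forall>i<n. R (x i) (f i)) \<and>
    (\<forall>i<n. \<forall>j<n. f i (x j) = (if i = j then 1 else 0)) \<and>
    (\<forall>v. v = (\<Sum>i<n. scale (f i v) (x i)))"
proof -
  define P where "P n x f \<longleftrightarrow> (\<forall>i<n. R (x i) (f i)) \<and>
    (\<forall>i<n. \<forall>j<n. f i (x j) = (if i = j then 1 else 0))" for n :: nat and x f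
  obtain B where B: "finite B" "span B = UNIV"
    using finite_dim by blast
  have "m \<le> card B" if "P m x f" for m x f
    by (rule biorthogonal_card_le[OF B, of m f x]) (use that dual in \<open>auto simp: P_def\<close>)
  then have "\<forall>m. (\<exists>x f. P m x f) \<longrightarrow> m \<le> card B"
    by blast
  moreover have "\<exists>x f. P 0 x f" by (simp add: P_def)
  ultimately obtain n where n: "\<exists>x f. P n x f" "\<And>m. \<exists>x f. P m x f \<Longrightarrow> m \<le> n"
    using Greatest_le_nat[of "\<lambda>n. \<exists>x f. P n x f" _ "card B"]
      GreatestI_nat[of "\<lambda>n. \<exists>x f. P n x f" 0 "card B"] by blast
  then obtain x f where xf: "P n x f" by blast
  have f_dual: "f i \<in> dual_space scale" if "i < n" for i
    using xf that dual by (auto simp: P_def)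
  have "v = (\<Sum>i<n. scale (f i v) (x i))" for v
  proof (rule ccontr)
    assume ne: "v \<noteq> (\<Sum>i<n. scale (f i v) (x i))"
    define u where "u = v - (\<Sum>i<n. scale (f i v) (x i))"
    have "f i u = 0" if i: "i < n" for i
    proof -
      have "(\<Sum>j<n. f j v * f i (x j)) = (\<Sum>j<n. if j = i then f j v else 0)"
        using xf i by (intro sum.cong refl) (auto simp: P_def)
      then show ?thesis
        using i by (simp add: u_def dual_diff dual_sum dual_scale f_dual)
    qed
    moreover have "u \<noteq> 0" using ne by (simp add: u_def)
    ultimately obtain y g where yg: "R y g" "g y = 1" "\<And>i. i < n \<Longrightarrow> g (x i) = 0 \<and> f i y = 0"
      using ext[of n x f u] xf unfolding P_def by blast
    have "P (Suc n) (x(n := y)) (f(n := g))"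
      using xf yg by (auto simp: P_def less_Suc_eq)
    then have "Suc n \<le> n" using n(2) by blast
    then show False by simp
  qed
  with xf show ?thesis unfolding P_def by blast
qed

text \<open>Boundedness of the coordinate functionals is built in by taking them from Hahn-Banach
  functionals; boundedness of all functionals follows from this, with no appeal to
  compactness.\<close>

lemma exists_bounded_basis:
  "\<exists>n (x :: nat \<Rightarrow> 'a) (f :: nat \<Rightarrow> 'a \<Rightarrow> 'k). (\<forall>i<n. f i \<in> dual_space scale \<and> (\<exists>C. \<forall>v. norm (f i v) \<le> C * nrm v)) \<and>
    (\<forall>i<n. \<forall>j<n. f i (x j) = (if i = j then 1 else 0)) \<and>
    (\<forall>v. v = (\<Sum>i<n. scale (f i v) (x i)))"
proof (rule complete_biorthogonal_system)
  fix n :: nat and x :: "nat \<Rightarrow> 'a" and f :: "nat \<Rightarrow> 'a \<Rightarrow> 'k" and v :: 'a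
  assume f: "\<And>i. i < n \<Longrightarrow> f i \<in> dual_space scale \<and> (\<exists>C. \<forall>v. norm (f i v) \<le> C * nrm v)"
    and biorth: "\<And>i j. i < n \<Longrightarrow> j < n \<Longrightarrow> f i (x j) = (if i = j then 1 else 0)"
    and v: "v \<noteq> 0" "\<And>i. i < n \<Longrightarrow> f i v = 0"
  obtain B where B: "finite B" "span B = UNIV"
    using finite_dim by blast
  obtain \<Phi> where \<Phi>: "\<And>x y. \<Phi> (x + y) = \<Phi> x + \<Phi> y" "\<And>c x. \<Phi> (scale c x) = c * \<Phi> x"
      "\<Phi> v = of_real (nrm v)" "\<And>x. norm (\<Phi> x) \<le> nrm x"
    by (rule Hahn_Banach_finite_span[OF vector_space_axioms B(1) B(2)[symmetric], of nrm v])
      (auto simp: nrm_triangle nrm_scale)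
  obtain C where C: "\<And>i v. i < n \<Longrightarrow> norm (f i v) \<le> C i * nrm v"
    using f by metis
  have v0: "nrm v \<noteq> 0" using v by (simp add: nrm_eq_0_iff)
  \<comment> \<open>The functional norming \<open>v\<close> is corrected so that it vanishes at the
    earlier \<open>x i\<close>. As all \<open>f i\<close> vanish at \<open>v\<close>, its value
    there is unaffected, and \<open>v\<close> itself is the new vector.\<close>
  define g where "g y = (\<Phi> y - (\<Sum>i<n. \<Phi> (x i) * f i y)) / of_real (nrm v)" for y
  have "g \<in> dual_space scale"
    using \<Phi> f unfolding dual_space_iff g_def
    by (auto simp: sum.distrib sum_distrib_left field_simps simp flip: add_divide_distrib)
  moreover have "norm (g y) \<le> ((1 + (\<Sum>i<n. norm (\<Phi> (x i)) * C i)) / nrm v) * nrm y" for y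
  proof -
    have "norm (\<Phi> y - (\<Sum>i<n. \<Phi> (x i) * f i y)) \<le> norm (\<Phi> y) + norm (\<Sum>i<n. \<Phi> (x i) * f i y)"
      by (rule norm_triangle_ineq4)
    also have "\<dots> \<le> nrm y + (\<Sum>i<n. norm (\<Phi> (x i)) * (C i * nrm y))"
      using \<Phi>(4) C by (intro add_mono order_trans[OF norm_sum] sum_mono) (auto simp: norm_mult intro: mult_left_mono)
    also have "\<dots> = (1 + (\<Sum>i<n. norm (\<Phi> (x i)) * C i)) * nrm y"
      by (simp add: sum_distrib_left distrib_left mult_ac)
    finally have "norm (\<Phi> y - (\<Sum>i<n. \<Phi> (x i) * f i y)) / nrm v \<le> (1 + (\<Sum>i<n. norm (\<Phi> (x i)) * C i)) * nrm y / nrm v"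
      by (intro divide_right_mono) auto
    then show ?thesis by (simp add: g_def norm_divide)
  qed
  moreover have "g v = 1"
    using v v0 by (simp add: g_def \<Phi>(3))
  moreover have "g (x j) = 0" if "j < n" for j
  proof -
    have "(\<Sum>i<n. \<Phi> (x i) * f i (x j)) = (\<Sum>i<n. if i = j then \<Phi> (x i) else 0)"
      using biorth that by (intro sum.cong refl) auto
    then show ?thesis using that by (simp add: g_def)
  qed
  ultimately show "\<exists>y g. (g \<in> dual_space scale \<and> (\<exists>C. \<forall>v. norm (g v) \<le> C * nrm v)) \<and> g y = 1 \<and>
      (\<forall>i<n. g (x i) = 0 \<and> f i y = 0)"
    using v(2) by (intro exI[of _ v] exI[of _ g] conjI exI[of _ "(1 + (\<Sum>i<n. norm (\<Phi> (x i)) * C i)) / nrm v"]) auto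
qed auto

lemma dual_bounded:
  assumes f: "f \<in> dual_space scale"
  obtains C where "C \<ge> 0" "\<And>v. norm (f v) \<le> C * nrm v"
proof -
  obtain n and x :: "nat \<Rightarrow> 'a" and h :: "nat \<Rightarrow> 'a \<Rightarrow> 'k" where
    h: "\<And>i. i < n \<Longrightarrow> \<exists>C. \<forall>v. norm (h i v) \<le> C * nrm v" and v: "\<And>v. v = (\<Sum>i<n. scale (h i v) (x i))"
    using exists_bounded_basis by blast
  obtain C where C: "\<And>i v. i < n \<Longrightarrow> norm (h i v) \<le> C i * nrm v"
    using h by metis
  have *: "norm (f u) \<le> (\<Sum>i<n. C i * norm (f (x i))) * nrm u" for u
  proof -
    have "f u = (\<Sum>i<n. h i u * f (x i))"
      using arg_cong[OF v[of u], of f] by (simp add: dual_sum dual_scale f)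
    also have "norm \<dots> \<le> (\<Sum>i<n. (C i * nrm u) * norm (f (x i)))"
      using C by (intro order_trans[OF norm_sum] sum_mono) (auto simp: norm_mult intro: mult_right_mono)
    also have "\<dots> = (\<Sum>i<n. C i * norm (f (x i))) * nrm u"
      by (simp add: sum_distrib_left mult_ac)
    finally show ?thesis .
  qed
  show ?thesis
  proof (rule that[of "\<bar>\<Sum>i<n. C i * norm (f (x i))\<bar>"])
    show "norm (f u) \<le> \<bar>\<Sum>i<n. C i * norm (f (x i))\<bar> * nrm u" for u
      by (rule order_trans[OF *]) (intro mult_right_mono, auto)
  qed simp
qed

lemma dual_norm_bdd:
  assumes f: "f \<in> dual_space scale"
  shows "bdd_above {norm (f x) | x. nrm x \<le> 1}"
proof -
  obtain C where C: "C \<ge> 0" "\<And>v. norm (f v) \<le> C * nrm v"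
    using dual_bounded[OF f] by blast
  have "norm (f x) \<le> C" if "nrm x \<le> 1" for x
    using C(2)[of x] mult_left_mono[OF that C(1)] by simp
  then show ?thesis by (intro bdd_aboveI) auto
qed

lemma dual_norm_ge_0:
  assumes f: "f \<in> dual_space scale"
  shows "dual_norm nrm f \<ge> 0"
proof -
  have "norm (f 0) \<le> dual_norm nrm f"
    unfolding dual_norm_def by (rule cSup_upper[OF _ dual_norm_bdd[OF f]]) (auto intro: exI[of _ 0])
  then show ?thesis by (simp add: dual_0 f)
qed

lemma norm_dual_le:
  assumes f: "f \<in> dual_space scale"
  shows "norm (f x) \<le> dual_norm nrm f * nrm x"
proof (cases "x = 0")
  case False
  then have x: "nrm x > 0" using nrm_ge_0[of x] nrm_eq_0_iff[of x] by linarith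
  have "norm (f (scale (of_real (1 / nrm x)) x)) \<le> dual_norm nrm f"
    unfolding dual_norm_def
    by (rule cSup_upper[OF _ dual_norm_bdd[OF f]]) (use x in \<open>auto intro!: exI simp: nrm_scale norm_divide\<close>)
  then show ?thesis
    using x by (simp add: dual_scale[OF f] norm_mult norm_divide field_simps)
qed (simp add: dual_0 f)

lemma dual_norm_le:
  assumes "C \<ge> 0" "\<And>x. norm (f x) \<le> C * nrm x"
  shows "dual_norm nrm f \<le> C"
  unfolding dual_norm_def
proof (rule cSup_least)
  show "{norm (f x) | x. nrm x \<le> 1} \<noteq> {}" by (auto intro: exI[of _ 0])
  fix t assume "t \<in> {norm (f x) | x. nrm x \<le> 1}"
  then obtain x where "t = norm (f x)" "nrm x \<le> 1" by blast
  then show "t \<le> C"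
    using assms(2)[of x] mult_left_mono[OF _ assms(1), of "nrm x" 1] by simp
qed

lemma norm_dual_ball_le:
  assumes "f \<in> dual_ball scale nrm"
  shows "norm (f x) \<le> nrm x"
  using assms norm_dual_le[of f x] mult_right_mono[of "dual_norm nrm f" 1 "nrm x"]
  by (auto simp: dual_ball_def)

lemma dual_ballI:
  assumes "f \<in> dual_space scale" "\<And>x. norm (f x) \<le> nrm x"
  shows "f \<in> dual_ball scale nrm"
  using assms dual_norm_le[of 1 f] by (simp add: dual_ball_def)

text \<open>This includes dual norm 0: then \<open>f\<close> vanishes, and so does its quotient by
  0.\<close>

lemma normalize_functional:
  assumes f: "f \<in> dual_space scale"
  obtains g where "g \<in> dual_ball scale nrm" "\<And>x. f x = of_real (dual_norm nrm f) * g x"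
proof (rule that[of "\<lambda>x. f x / of_real (dual_norm nrm f)"])
  let ?c = "dual_norm nrm f"
  have c: "?c \<ge> 0" by (rule dual_norm_ge_0[OF f])
  have zero: "f x = 0" if "?c = 0" for x
    using norm_dual_le[OF f, of x] that by simp
  show "f x = of_real ?c * (f x / of_real ?c)" for x
    using zero by (cases "?c = 0") auto
  show "(\<lambda>x. f x / of_real ?c) \<in> dual_ball scale nrm"
  proof (rule dual_ballI)
    show "(\<lambda>x. f x / of_real ?c) \<in> dual_space scale"
      using f by (simp add: dual_space_iff add_divide_distrib)
    show "norm (f x / of_real ?c) \<le> nrm x" for x
      using norm_dual_le[OF f, of x] c by (cases "?c = 0") (auto simp: norm_divide field_simps)
  qed
qed

subsection \<open>Orthonormal bases\<close>

text \<open>Gram-Schmidt in the form of completing a biorthogonal system whose functionals are the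
  inner products with its vectors; the new vector is the normalized residual.\<close>

lemma exists_orthonormal_basis:
  assumes "euclidean_norm cj scale nrm"
  shows "\<exists>(n::nat) e f. (\<forall>i<n. f i \<in> dual_space scale) \<and>
    (\<forall>i<n. \<forall>j<n. f i (e j) = (if i = j then 1 else 0)) \<and>
    (\<forall>v. v = (\<Sum>i<n. scale (f i v) (e i))) \<and>
    (\<forall>v. (nrm v)\<^sup>2 = (\<Sum>i<n. (norm (f i v))\<^sup>2))"
proof -
  obtain ip where ip_nrm: "is_inner_product cj scale ip \<and> (\<forall>x. of_real ((nrm x)\<^sup>2) = ip x x)"
    using assms unfolding euclidean_norm_def by (rule exE)
  have ip: "is_inner_product cj scale ip" by (rule ip_nrm[THEN conjunct1])
  have nrm: "of_real ((nrm x)\<^sup>2) = ip x x" for x by (rule ip_nrm[THEN conjunct2, THEN spec])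
  have ip_dual: "(\<lambda>x. ip x y) \<in> dual_space scale" for y
    using ip unfolding is_inner_product_def dual_space_def by blast
  have ip_cj: "ip y x = cj (ip x y)" for x y
    using ip unfolding is_inner_product_def by blast
  have cj_0: "cj 0 = 0" using cj_of_real[of 0] by simp
  have "\<exists>(n::nat) e f. (\<forall>i<n. f i = (\<lambda>x. ip x (e i)) \<and> ip (e i) (e i) = 1) \<and>
    (\<forall>i<n. \<forall>j<n. f i (e j) = (if i = j then 1 else 0)) \<and>
    (\<forall>v. v = (\<Sum>i<n. scale (f i v) (e i)))"
  proof (rule complete_biorthogonal_system)
    fix n :: nat and x :: "nat \<Rightarrow> 'a" and f :: "nat \<Rightarrow> 'a \<Rightarrow> 'k" and v :: 'a
    assume f: "\<And>i. i < n \<Longrightarrow> f i = (\<lambda>y. ip y (x i)) \<and> ip (x i) (x i) = 1"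
      and v: "v \<noteq> 0" "\<And>i. i < n \<Longrightarrow> f i v = 0"
    have v0: "nrm v \<noteq> 0" using v by (simp add: nrm_eq_0_iff)
    let ?c = "of_real (1 / nrm v) :: 'k"
    define y where "y = scale ?c v"
    have "nrm y = 1"
      using v0 by (simp add: y_def nrm_scale norm_divide)
    then have "ip y y = 1"
      using nrm[of y] by simp
    moreover have fy: "f i y = 0" if "i < n" for i
      using f[OF that] v(2)[OF that] by (simp add: y_def dual_scale[OF ip_dual])
    moreover have "ip (x i) y = 0" if "i < n" for i
      using fy[OF that] f[OF that] by (subst ip_cj) (simp add: cj_0)
    ultimately show "\<exists>y g. (g = (\<lambda>x. ip x y) \<and> ip y y = 1) \<and> g y = 1 \<and> (\<forall>i<n. g (x i) = 0 \<and> f i y = 0)"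
      by (intro exI[of _ y] exI[of _ "\<lambda>x. ip x y"]) auto
  qed (auto simp: ip_dual)
  then obtain n and e :: "nat \<Rightarrow> 'a" and f :: "nat \<Rightarrow> 'a \<Rightarrow> 'k" where
    f: "\<And>i. i < n \<Longrightarrow> f i = (\<lambda>x. ip x (e i))" and
    biorth: "\<And>i j. i < n \<Longrightarrow> j < n \<Longrightarrow> f i (e j) = (if i = j then 1 else 0)" and
    exp: "\<And>v. v = (\<Sum>i<n. scale (f i v) (e i))"
    by blast
  have "(nrm v)\<^sup>2 = (\<Sum>i<n. (norm (f i v))\<^sup>2)" for v
  proof -
    have "of_real ((nrm v)\<^sup>2) = ip (\<Sum>i<n. scale (f i v) (e i)) v"
      by (subst exp[of v, symmetric]) (rule nrm)
    also have "\<dots> = (\<Sum>i<n. f i v * ip (e i) v)"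
      by (simp add: dual_sum[OF ip_dual] dual_scale[OF ip_dual])
    also have "\<dots> = (\<Sum>i<n. f i v * cj (f i v))"
      by (intro sum.cong refl) (metis f ip_cj lessThan_iff)
    also have "\<dots> = (\<Sum>i<n. of_real ((norm (f i v))\<^sup>2))"
      by (simp only: mult_cj)
    also have "\<dots> = of_real (\<Sum>i<n. (norm (f i v))\<^sup>2)" by (rule of_real_sum[symmetric])
    finally show ?thesis by (simp only: of_real_eq_iff)
  qed
  moreover have "f i \<in> dual_space scale" if "i < n" for i
    unfolding f[OF that] by (rule ip_dual)
  ultimately show ?thesis
    using biorth exp by (intro exI[of _ n] exI[of _ e] exI[of _ f] conjI allI impI)
qed

end

subsection \<open>Tensor powers\<close>

lemma multilinear_form_slot:
  assumes "multilinear_form s k A" "length xs = k" "i < k"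
  shows "A (xs[i := x + y]) = A (xs[i := x]) + A (xs[i := y])"
    and "A (xs[i := s c x]) = c * A (xs[i := x])"
  using assms by (auto simp: multilinear_form_def Vector_Spaces.linear_iff)

lemma multilinear_form_sum_slot:
  assumes A: "multilinear_form s k A" and xs: "length xs = k" "i < k"
  shows "A (xs[i := (\<Sum>l\<in>L. s (c l) (y l))]) = (\<Sum>l\<in>L. c l * A (xs[i := y l]))"
proof -
  have zero: "A (xs[i := 0]) = 0"
    using multilinear_form_slot(1)[OF A xs, of 0 0] by (simp only: add_0_right add_cancel_right_right)
  show ?thesis
    by (induction L rule: infinite_finite_induct)
      (auto simp: zero multilinear_form_slot[OF A xs])
qed

lemma multilinear_form_expand:
  assumes A: "multilinear_form s k A" and xs: "length xs = k"
    and eq: "\<And>j. j < k \<Longrightarrow> xs ! j = (\<Sum>i<m. s (c j i) (y i))"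
  shows "A xs = (\<Sum>I\<in>multi_indices m k. (\<Prod>j<k. c j (I ! j)) * A (map y I))"
proof -
  \<comment> \<open>After \<open>r\<close> steps the first \<open>r\<close> slots are expanded and
    \<open>drop r xs\<close> is still untouched.\<close>
  have "A xs = (\<Sum>I\<in>multi_indices m r. (\<Prod>j<r. c j (I ! j)) * A (map y I @ drop r xs))" if "r \<le> k" for r
    using that
  proof (induction r)
    case 0
    have "multi_indices m 0 = {[]}" by (auto simp: multi_indices_def)
    then show ?case by simp
  next
    case (Suc r)
    have step: "A (map y I @ drop r xs) = (\<Sum>i<m. c r i * A (map y (I @ [i]) @ drop (Suc r) xs))"
      if I: "I \<in> multi_indices m r" for I
    proof -
      have upd: "(map y I @ drop r xs)[r := v] = map y I @ v # drop (Suc r) xs" for v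
        using Suc.prems xs length_multi_indices[OF I]
        by (simp add: list_update_append Cons_nth_drop_Suc[symmetric])
      have "map y I @ drop r xs = (map y I @ drop r xs)[r := (\<Sum>i<m. s (c r i) (y i))]"
        unfolding upd using Suc.prems xs by (simp add: eq[of r, symmetric] Cons_nth_drop_Suc)
      then have "A (map y I @ drop r xs) = A ((map y I @ drop r xs)[r := (\<Sum>i<m. s (c r i) (y i))])"
        by (rule arg_cong)
      also have "\<dots> = (\<Sum>i<m. c r i * A ((map y I @ drop r xs)[r := y i]))"
        using Suc.prems xs length_multi_indices[OF I] by (intro multilinear_form_sum_slot[OF A]) auto
      finally show ?thesis unfolding upd by simp
    qed
    have "A xs = (\<Sum>I\<in>multi_indices m r. (\<Prod>j<r. c j (I ! j)) * A (map y I @ drop r xs))"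
      using Suc by simp
    also have "\<dots> = (\<Sum>I\<in>multi_indices m r. \<Sum>i<m. (\<Prod>j<r. c j (I ! j)) * c r i * A (map y (I @ [i]) @ drop (Suc r) xs))"
      by (intro sum.cong refl) (simp only: step sum_distrib_left mult.assoc)
    also have "\<dots> = (\<Sum>I\<in>multi_indices m (Suc r). (\<Prod>j<Suc r. c j (I ! j)) * A (map y I @ drop (Suc r) xs))"
      unfolding sum_multi_indices_Suc
      by (intro sum.cong refl) (simp add: nth_append length_multi_indices)
    finally show ?case .
  qed
  from this[of k] show ?thesis using xs by simp
qed

lemma vector_space_pointwise:
  assumes "vector_space (s :: 'k::field \<Rightarrow> 'b::ab_group_add \<Rightarrow> 'b)"
  shows "vector_space (\<lambda>c (f :: 'a \<Rightarrow> 'b) x. s c (f x))"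
proof -
  interpret vector_space s by (rule assms)
  show ?thesis
    by unfold_locales (auto simp: fun_eq_iff scale_right_distrib scale_left_distrib)
qed

lemma tensor_power_induct [consumes 1, case_names zero step]:
  assumes "z \<in> tensor_power s k"
    and "P (\<lambda>_. 0)"
    and "\<And>c xs z. length xs = k \<Longrightarrow> P z \<Longrightarrow> P (\<lambda>A. c * elementary_tensor s k xs A + z A)"
  shows "P z"
proof -
  interpret vector_space "\<lambda>c (z :: ('a list \<Rightarrow> 'k::field) \<Rightarrow> 'k) A. c * z A"
    using vector_space_pointwise[OF vector_space_mult] .
  show ?thesis
    using assms(1) unfolding tensor_power_def
  proof (induction rule: span_induct_alt)
    case base
    then show ?case using assms(2) by (simp add: zero_fun_def)
  next
    case (step c x y)
    then show ?case using assms(3)[of _ y c] by (auto simp: plus_fun_def)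
  qed
qed

lemma sum_elementary_in_tensor_power:
  assumes "\<And>i. i \<in> S \<Longrightarrow> length (x i) = k"
  shows "(\<lambda>A. \<Sum>i\<in>S. c i * elementary_tensor s k (x i) A) \<in> tensor_power s k"
proof -
  interpret vector_space "\<lambda>c (z :: ('b list \<Rightarrow> 'c::field) \<Rightarrow> 'c) A. c * z A"
    using vector_space_pointwise[OF vector_space_mult] .
  have "(\<Sum>i\<in>S. (\<lambda>A. c i * elementary_tensor s k (x i) A)) \<in> tensor_power s k"
    unfolding tensor_power_def
    by (intro span_sum span_scale span_base) (use assms in auto)
  moreover have "(\<Sum>i\<in>S. (\<lambda>A. c i * elementary_tensor s k (x i) A)) =
      (\<lambda>A. \<Sum>i\<in>S. c i * elementary_tensor s k (x i) A)"
    by (induction S rule: infinite_finite_induct) (auto simp: fun_eq_iff)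
  ultimately show ?thesis by simp
qed

section \<open>Estimates for the injective and projective norms\<close>

context scalar_normed_space
begin

lemma functional_tensor_elementary_dual_ball:
  assumes "length \<phi>s = k" "set \<phi>s \<subseteq> dual_ball scale nrm"
  shows "elementary_tensor scale k xs (functional_tensor \<phi>s) = (\<Prod>i<k. (\<phi>s ! i) (xs ! i))"
  using functional_tensor_elementary[OF vector_space_axioms assms(1)] assms(2)
  by (auto simp: dual_ball_def)

text \<open>Makes the supremum in \<open>injective_norm\<close> one of a bounded set; the bound
  grows by one elementary tensor at a time.\<close>

lemma injective_norm_bounded:
  assumes "z \<in> tensor_power scale k"
  shows "\<exists>C. \<forall>\<phi>s. length \<phi>s = k \<longrightarrow> set \<phi>s \<subseteq> dual_ball scale nrm \<longrightarrow> norm (z (functional_tensor \<phi>s)) \<le> C"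
  using assms
proof (induction rule: tensor_power_induct)
  case zero
  then show ?case by auto
next
  case (step c xs z)
  then obtain C where C: "\<And>\<phi>s. length \<phi>s = k \<Longrightarrow> set \<phi>s \<subseteq> dual_ball scale nrm \<Longrightarrow> norm (z (functional_tensor \<phi>s)) \<le> C"
    by blast
  have "norm (c * elementary_tensor scale k xs (functional_tensor \<phi>s) + z (functional_tensor \<phi>s)) \<le>
      norm c * (\<Prod>j<k. nrm (xs ! j)) + C"
    if \<phi>s: "length \<phi>s = k" "set \<phi>s \<subseteq> dual_ball scale nrm" for \<phi>s
  proof -
    have "norm (\<Prod>j<k. (\<phi>s ! j) (xs ! j)) \<le> (\<Prod>j<k. nrm (xs ! j))"
      using \<phi>s by (subst prod_norm[symmetric], intro prod_mono) (auto intro!: norm_dual_ball_le)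
    then show ?thesis
      using \<phi>s C[OF \<phi>s] unfolding functional_tensor_elementary_dual_ball[OF \<phi>s]
      by (intro order_trans[OF norm_triangle_ineq] add_mono) (auto simp: norm_mult intro: mult_left_mono)
  qed
  then show ?case by blast
qed

lemma norm_le_injective_norm:
  assumes "z \<in> tensor_power scale k" "length \<phi>s = k" "set \<phi>s \<subseteq> dual_ball scale nrm"
  shows "norm (z (functional_tensor \<phi>s)) \<le> injective_norm scale nrm k z"
  unfolding injective_norm_def
proof (rule cSup_upper)
  obtain C where "\<And>\<phi>s. length \<phi>s = k \<Longrightarrow> set \<phi>s \<subseteq> dual_ball scale nrm \<Longrightarrow> norm (z (functional_tensor \<phi>s)) \<le> C"
    using injective_norm_bounded[OF assms(1)] by blast
  then show "bdd_above {norm (z (functional_tensor \<phi>s)) | \<phi>s. length \<phi>s = k \<and> set \<phi>s \<subseteq> dual_ball scale nrm}"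
    by (intro bdd_aboveI) auto
qed (use assms in auto)

lemma zero_in_dual_ball: "(\<lambda>_. 0) \<in> dual_ball scale nrm"
  by (intro dual_ballI dual_space_zero) simp

lemma injective_norm_le:
  assumes "\<And>\<phi>s. length \<phi>s = k \<Longrightarrow> set \<phi>s \<subseteq> dual_ball scale nrm \<Longrightarrow> norm (z (functional_tensor \<phi>s)) \<le> C"
  shows "injective_norm scale nrm k z \<le> C"
  unfolding injective_norm_def
proof (rule cSup_least)
  show "{norm (z (functional_tensor \<phi>s)) | \<phi>s. length \<phi>s = k \<and> set \<phi>s \<subseteq> dual_ball scale nrm} \<noteq> {}"
    using zero_in_dual_ball by (auto intro!: exI[of _ "replicate k (\<lambda>_. 0)"])
qed (use assms in auto)

lemma injective_norm_ge_0:
  assumes "z \<in> tensor_power scale k"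
  shows "injective_norm scale nrm k z \<ge> 0"
proof -
  have "norm (z (functional_tensor (replicate k (\<lambda>_. 0)))) \<le> injective_norm scale nrm k z"
    using zero_in_dual_ball by (intro norm_le_injective_norm assms) auto
  then show ?thesis by (rule order_trans[OF norm_ge_zero])
qed

text \<open>\<open>projective_norm\<close> is an infimum over sums of elementary tensors without
  coefficients. A coefficient is absorbed by slot 0, which exists for
  \<open>k \<ge> 1\<close>.\<close>

lemma scaled_elementary:
  assumes "length xs = k" "k \<ge> 1"
  shows "c * elementary_tensor scale k xs A = elementary_tensor scale k (xs[0 := scale c (xs ! 0)]) A"
  using multilinear_form_slot(2)[of scale k A xs 0 c "xs ! 0"] assms
  by (auto simp: elementary_tensor_def)

lemma weighted_sum_projective_value:
  assumes S: "finite S" and x: "\<And>i. i \<in> S \<Longrightarrow> length (x i) = k" and k: "k \<ge> 1"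
    and z: "\<And>A. z A = (\<Sum>i\<in>S. c i * elementary_tensor scale k (x i) A)"
  shows "(\<Sum>i\<in>S. norm (c i) * (\<Prod>j<k. nrm (x i ! j))) \<in>
    {\<Sum>i<m. \<Prod>j<k. nrm (x i ! j) | (m::nat) (x :: nat \<Rightarrow> 'a list).
      (\<forall>i<m. length (x i) = k) \<and> z = (\<Sum>i<m. elementary_tensor scale k (x i))}"
proof -
  obtain h where h: "bij_betw h {..<card S} S"
    using ex_bij_betw_nat_finite[OF S] by (auto simp: atLeast0LessThan)
  let ?x = "\<lambda>i. (x i)[0 := scale (c i) (x i ! 0)]"
  have len: "length (x (h l)) = k" if "l < card S" for l
    using h x that by (auto simp: bij_betw_def)
  have "z = (\<Sum>l<card S. elementary_tensor scale k (?x (h l)))"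
  proof
    fix A
    have eval: "(\<Sum>i<m. elementary_tensor scale k (y i)) A = (\<Sum>i<m. elementary_tensor scale k (y i) A)"
      for m and y :: "nat \<Rightarrow> 'a list"
      by (induction m) auto
    have "z A = (\<Sum>l<card S. c (h l) * elementary_tensor scale k (x (h l)) A)"
      unfolding z by (rule sum.reindex_bij_betw[OF h, symmetric])
    also have "\<dots> = (\<Sum>l<card S. elementary_tensor scale k (?x (h l)) A)"
      by (intro sum.cong refl) (simp add: scaled_elementary[OF len k])
    finally show "z A = (\<Sum>l<card S. elementary_tensor scale k (?x (h l))) A"
      by (simp add: eval)
  qed
  moreover have "(\<Sum>i\<in>S. norm (c i) * (\<Prod>j<k. nrm (x i ! j))) = (\<Sum>l<card S. \<Prod>j<k. nrm (?x (h l) ! j))"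
  proof -
    have 0: "(0::nat) \<in> {..<k}" using k by simp
    have "norm (c i) * (\<Prod>j<k. nrm (x i ! j)) = (\<Prod>j<k. nrm (?x i ! j))" if i: "i \<in> S" for i
    proof -
      have "(\<Prod>j<k. nrm (?x i ! j)) = nrm (?x i ! 0) * (\<Prod>j\<in>{..<k} - {0}. nrm (?x i ! j))"
        by (rule prod.remove[OF _ 0]) simp
      also have "\<dots> = norm (c i) * (nrm (x i ! 0) * (\<Prod>j\<in>{..<k} - {0}. nrm (x i ! j)))"
        using x[OF i] k by (simp add: nrm_scale)
      also have "\<dots> = norm (c i) * (\<Prod>j<k. nrm (x i ! j))"
        by (subst prod.remove[OF _ 0]) auto
      finally show ?thesis ..
    qed
    then have "(\<Sum>i\<in>S. norm (c i) * (\<Prod>j<k. nrm (x i ! j))) = (\<Sum>i\<in>S. \<Prod>j<k. nrm (?x i ! j))"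
      by (intro sum.cong refl)
    also have "\<dots> = (\<Sum>l<card S. \<Prod>j<k. nrm (?x (h l) ! j))"
      by (rule sum.reindex_bij_betw[OF h, symmetric])
    finally show ?thesis .
  qed
  moreover have "\<forall>l<card S. length (?x (h l)) = k" by (simp add: len)
  ultimately show ?thesis
    by (intro CollectI exI[of _ "card S"] exI[of _ "\<lambda>l. ?x (h l)"] conjI)
qed

lemma projective_norm_le_weighted_sum:
  assumes "finite S" "\<And>i. i \<in> S \<Longrightarrow> length (x i) = k" "k \<ge> 1"
    and "\<And>A. z A = (\<Sum>i\<in>S. c i * elementary_tensor scale k (x i) A)"
  shows "projective_norm scale nrm k z \<le> (\<Sum>i\<in>S. norm (c i) * (\<Prod>j<k. nrm (x i ! j)))"
  unfolding projective_norm_def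
  by (rule cInf_lower[OF weighted_sum_projective_value[OF assms]])
    (auto intro!: bdd_belowI[of _ 0] sum_nonneg prod_nonneg)

text \<open>The easy half of the duality between the projective norm and bounded
  \<open>k\<close>-linear forms: the bound holds for every representation of \<open>z\<close>. The
  given representation makes the infimum one over a nonempty set.\<close>

lemma multilinear_form_le_projective_norm:
  assumes S: "finite S" and x: "\<And>i. i \<in> S \<Longrightarrow> length (x i) = k" and k: "k \<ge> 1"
    and z: "\<And>A. z A = (\<Sum>i\<in>S. c i * elementary_tensor scale k (x i) A)"
    and B: "multilinear_form scale k B"
    and M: "\<And>ys. length ys = k \<Longrightarrow> norm (B ys) \<le> M * (\<Prod>j<k. nrm (ys ! j))" "M > 0"
  shows "norm (z B) \<le> M * projective_norm scale nrm k z"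
proof -
  have "norm (z B) / M \<le> projective_norm scale nrm k z"
    unfolding projective_norm_def
  proof (rule cInf_greatest)
    show "{\<Sum>i<m. \<Prod>j<k. nrm (x i ! j) | (m::nat) (x :: nat \<Rightarrow> 'a list).
      (\<forall>i<m. length (x i) = k) \<and> z = (\<Sum>i<m. elementary_tensor scale k (x i))} \<noteq> {}"
      using weighted_sum_projective_value[OF S x k z] by blast
  next
    fix t
    assume "t \<in> {\<Sum>i<m. \<Prod>j<k. nrm (x i ! j) | (m::nat) (x :: nat \<Rightarrow> 'a list).
        (\<forall>i<m. length (x i) = k) \<and> z = (\<Sum>i<m. elementary_tensor scale k (x i))}"
    then obtain m :: nat and y :: "nat \<Rightarrow> 'a list" where t: "t = (\<Sum>i<m. \<Prod>j<k. nrm (y i ! j))"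
      and y: "\<And>i. i < m \<Longrightarrow> length (y i) = k" and zy: "z = (\<Sum>i<m. elementary_tensor scale k (y i))"
      by blast
    have "(\<Sum>i<m. elementary_tensor scale k (y i)) B = (\<Sum>i<m. elementary_tensor scale k (y i) B)" for m
      by (induction m) auto
    then have "z B = (\<Sum>i<m. B (y i))"
      using B by (simp add: zy elementary_tensor_def)
    then have "norm (z B) \<le> (\<Sum>i<m. M * (\<Prod>j<k. nrm (y i ! j)))"
      using M(1) y by (auto intro!: order_trans[OF norm_sum] sum_mono)
    also have "\<dots> = M * t" by (simp add: t sum_distrib_left)
    finally show "norm (z B) / M \<le> t" using M(2) by (simp add: field_simps)
  qed
  then show ?thesis using M(2) by (simp add: field_simps)
qed

end

context scalars
begin

lemma sign_form_mult_slots: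
  "sign_form n k e (\<lambda>j i. t j * a j i) = (\<Prod>j<k. t j) * sign_form n k e a"
  unfolding sign_form_def by (simp add: prod.distrib sum_distrib_left mult_ac)

end

text \<open>Serves the Riesz-type arguments below, in which a square sum \<open>S\<close> is bounded
  by testing with an element of norm at most \<open>sqrt S\<close>.\<close>

lemma le_square_of_le_mult_sqrt:
  fixes S a :: real
  assumes "S \<ge> 0" "S \<le> a * sqrt S"
  shows "S \<le> a\<^sup>2"
proof (cases "S = 0")
  case False
  with assms have S: "sqrt S > 0" by simp
  have "sqrt S * sqrt S \<le> a * sqrt S" using assms by simp
  then have "sqrt S \<le> a" using S by (rule mult_right_le_imp_le)
  then have "(sqrt S)\<^sup>2 \<le> a\<^sup>2" using S by (intro power_mono) auto
  then show ?thesis using assms by simp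
qed simp

locale scalar_normed_pair =
  X: scalar_normed_space cj re im w sX nX + Y: scalar_normed_space cj re im w sY nY
  for cj :: "'k::real_normed_field \<Rightarrow> 'k" and re im w
    and sX :: "'k \<Rightarrow> 'a::ab_group_add \<Rightarrow> 'a" and nX
    and sY :: "'k \<Rightarrow> 'b::ab_group_add \<Rightarrow> 'b" and nY
begin

abbreviation linear_map :: "('a \<Rightarrow> 'b) \<Rightarrow> bool" where
  "linear_map T \<equiv> Vector_Spaces.linear sX sY T"

lemma linear_map_iff:
  "linear_map T \<longleftrightarrow> (\<forall>x y. T (x + y) = T x + T y) \<and> (\<forall>c x. T (sX c x) = sY c (T x))"
  using X.vector_space_axioms Y.vector_space_axioms by (auto simp: Vector_Spaces.linear_iff)

lemma linear_map_sum:
  assumes "linear_map T"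
  shows "T (\<Sum>i\<in>I. sX (c i) (x i)) = (\<Sum>i\<in>I. sY (c i) (T (x i)))"
proof -
  have "T 0 = 0"
    using assms unfolding linear_map_iff by (metis X.scale_zero_left Y.scale_zero_left)
  then show ?thesis
    using assms by (induction I rule: infinite_finite_induct) (auto simp: linear_map_iff)
qed

lemma dual_comp_linear_map:
  assumes "linear_map T" "f \<in> dual_space sY"
  shows "(\<lambda>x. f (T x)) \<in> dual_space sX"
  using assms by (simp add: linear_map_iff X.dual_space_iff Y.dual_space_iff)

subsection \<open>The upper bound\<close>

lemma tensor_map_expand:
  assumes T: "linear_map T" and g: "\<And>i. i < m \<Longrightarrow> g i \<in> dual_ball sX nX"
    and eq: "\<And>x. T x = (\<Sum>i<m. sY (g i x) (y i))"
    and z: "z \<in> tensor_power sX k"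
  shows "tensor_map sY k T z A =
    (\<Sum>I\<in>multi_indices m k. z (functional_tensor (map g I)) * elementary_tensor sY k (map y I) A)"
proof (cases "multilinear_form sY k A")
  case True
  have "z (\<lambda>xs. A (map T xs)) = (\<Sum>I\<in>multi_indices m k. z (functional_tensor (map g I)) * A (map y I))"
    using z
  proof (induction rule: tensor_power_induct)
    case zero
    then show ?case by simp
  next
    case (step c xs z)
    have "elementary_tensor sX k xs (\<lambda>xs. A (map T xs)) = A (map T xs)"
      using multilinear_form_pullback[OF T True] by (simp add: elementary_tensor_def)
    also have "\<dots> = (\<Sum>I\<in>multi_indices m k. (\<Prod>j<k. g (I ! j) (xs ! j)) * A (map y I))"
      by (rule multilinear_form_expand[OF True]) (use step eq in auto)
    also have "\<dots> = (\<Sum>I\<in>multi_indices m k. elementary_tensor sX k xs (functional_tensor (map g I)) * A (map y I))"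
    proof (intro sum.cong refl arg_cong2[of _ _ _ _ "(*)"])
      fix I assume I: "I \<in> multi_indices m k"
      have "set (map g I) \<subseteq> dual_ball sX nX" using I g by (auto simp: multi_indices_def)
      then show "(\<Prod>j<k. g (I ! j) (xs ! j)) = elementary_tensor sX k xs (functional_tensor (map g I))"
        using I by (subst X.functional_tensor_elementary_dual_ball) (auto simp: length_multi_indices)
    qed
    finally show ?case
      using step by (simp add: sum_distrib_left distrib_left sum.distrib mult_ac)
  qed
  then show ?thesis using True by (simp add: tensor_map_def elementary_tensor_def)
qed (simp add: tensor_map_def elementary_tensor_def)

lemma projective_norm_tensor_map_le:
  fixes m :: nat
  assumes T: "linear_map T" and g: "\<And>i. i < m \<Longrightarrow> g i \<in> dual_ball sX nX"
    and eq: "\<And>x. T x = (\<Sum>i<m. sY (g i x) (y i))"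
    and z: "z \<in> tensor_power sX k" and k: "k \<ge> 1"
  shows "projective_norm sY nY k (tensor_map sY k T z) \<le> (\<Sum>i<m. nY (y i)) ^ k * injective_norm sX nX k z"
proof -
  have "projective_norm sY nY k (tensor_map sY k T z) \<le>
      (\<Sum>I\<in>multi_indices m k. norm (z (functional_tensor (map g I))) * (\<Prod>j<k. nY (map y I ! j)))"
    by (rule Y.projective_norm_le_weighted_sum[OF finite_multi_indices _ k tensor_map_expand[OF T g eq z]])
      (auto simp: length_multi_indices)
  also have "\<dots> \<le> (\<Sum>I\<in>multi_indices m k. injective_norm sX nX k z * (\<Prod>j<k. nY (y (I ! j))))"
  proof (intro sum_mono mult_mono)
    fix I assume I: "I \<in> multi_indices m k"
    show "norm (z (functional_tensor (map g I))) \<le> injective_norm sX nX k z"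
      using I g by (intro X.norm_le_injective_norm[OF z]) (auto simp: multi_indices_def)
    show "(\<Prod>j<k. nY (map y I ! j)) \<le> (\<Prod>j<k. nY (y (I ! j)))"
      using I by (simp add: length_multi_indices)
  qed (auto intro: prod_nonneg X.injective_norm_ge_0[OF z])
  also have "\<dots> = injective_norm sX nX k z * (\<Prod>j<k. \<Sum>i<m. nY (y i))"
    by (simp only: sum_distrib_left[symmetric] sum_prod_multi_indices[of "\<lambda>j i. nY (y i)"])
  finally show ?thesis by (simp add: mult.commute)
qed

subsection \<open>The nuclear norm and trace duality\<close>

lemma nuclear_norm_le:
  fixes m :: nat
  assumes "\<And>i. i < m \<Longrightarrow> f i \<in> dual_space sX" "\<And>x. T x = (\<Sum>i<m. sY (f i x) (y i))"
  shows "nuclear_norm sX nX sY nY T \<le> (\<Sum>i<m. nY (y i) * dual_norm nX (f i))"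
  unfolding nuclear_norm_def
proof (rule cInf_lower)
  show "(\<Sum>i<m. nY (y i) * dual_norm nX (f i)) \<in>
    {\<Sum>i<m. nY (y i) * dual_norm nX (f i) | (m::nat) (f :: nat \<Rightarrow> 'a \<Rightarrow> 'k) (y :: nat \<Rightarrow> 'b).
      (\<forall>i<m. f i \<in> dual_space sX) \<and> (\<forall>x. T x = (\<Sum>i<m. sY (f i x) (y i)))}"
    by (intro CollectI exI[of _ m] exI[of _ f] exI[of _ y] conjI refl allI impI assms)
  show "bdd_below {\<Sum>i<m. nY (y i) * dual_norm nX (f i) | (m::nat) (f :: nat \<Rightarrow> 'a \<Rightarrow> 'k) (y :: nat \<Rightarrow> 'b).
      (\<forall>i<m. f i \<in> dual_space sX) \<and> (\<forall>x. T x = (\<Sum>i<m. sY (f i x) (y i)))}"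
    by (intro bdd_belowI[of _ 0]) (auto intro!: sum_nonneg mult_nonneg_nonneg X.dual_norm_ge_0)
qed

lemma nuclear_norm_le_dual_ball:
  fixes m :: nat
  assumes "\<And>i. i < m \<Longrightarrow> g i \<in> dual_ball sX nX" "\<And>x. T x = (\<Sum>i<m. sY (g i x) (y i))"
  shows "nuclear_norm sX nX sY nY T \<le> (\<Sum>i<m. nY (y i))"
proof -
  have "nuclear_norm sX nX sY nY T \<le> (\<Sum>i<m. nY (y i) * dual_norm nX (g i))"
    using assms by (intro nuclear_norm_le) (auto simp: dual_ball_def)
  also have "\<dots> \<le> (\<Sum>i<m. nY (y i))"
    using assms(1) by (intro sum_mono mult_left_le) (auto simp: dual_ball_def)
  finally show ?thesis .
qed

lemma linear_map_representation:
  assumes T: "linear_map T"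
  shows "\<exists>(m::nat) f y. (\<forall>i<m. f i \<in> dual_space sX) \<and> (\<forall>x. T x = (\<Sum>i<m. sY (f i x) (y i)))"
proof -
  obtain n and v :: "nat \<Rightarrow> 'a" and f :: "nat \<Rightarrow> 'a \<Rightarrow> 'k" where
    f: "\<And>i. i < n \<Longrightarrow> f i \<in> dual_space sX" and v: "\<And>x. x = (\<Sum>i<n. sX (f i x) (v i))"
    using X.exists_bounded_basis by blast
  have rep: "T x = (\<Sum>i<n. sY (f i x) (T (v i)))" for x
    by (rule trans[OF arg_cong[OF v[of x], of T] linear_map_sum[OF T]])
  show ?thesis
    by (intro exI[of _ n] exI[of _ f] exI[of _ "\<lambda>i. T (v i)"] conjI allI impI f rep)
qed

lemma nuclear_values_nonempty:
  assumes T: "linear_map T"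
  shows "{\<Sum>i<m. nY (y i) * dual_norm nX (f i) | (m::nat) (f :: nat \<Rightarrow> 'a \<Rightarrow> 'k) (y :: nat \<Rightarrow> 'b).
      (\<forall>i<m. f i \<in> dual_space sX) \<and> (\<forall>x. T x = (\<Sum>i<m. sY (f i x) (y i)))} \<noteq> {}"
proof -
  obtain m :: nat and f y where "\<forall>i<m. f i \<in> dual_space sX" "\<forall>x. T x = (\<Sum>i<m. sY (f i x) (y i))"
    using linear_map_representation[OF T] by blast
  then have "(\<Sum>i<m. nY (y i) * dual_norm nX (f i)) \<in>
    {\<Sum>i<m. nY (y i) * dual_norm nX (f i) | (m::nat) (f :: nat \<Rightarrow> 'a \<Rightarrow> 'k) (y :: nat \<Rightarrow> 'b).
      (\<forall>i<m. f i \<in> dual_space sX) \<and> (\<forall>x. T x = (\<Sum>i<m. sY (f i x) (y i)))}"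
    by (intro CollectI exI[of _ m] exI[of _ f] exI[of _ y] conjI refl)
  then show ?thesis by (rule ex_in_conv[THEN iffD1, OF exI])
qed

lemma nuclear_norm_ge_0:
  assumes T: "linear_map T"
  shows "nuclear_norm sX nX sY nY T \<ge> 0"
  unfolding nuclear_norm_def
proof (rule cInf_greatest[OF nuclear_values_nonempty[OF T]])
qed (auto intro!: sum_nonneg mult_nonneg_nonneg X.dual_norm_ge_0)

text \<open>The dual norms are moved into the vectors, so that the functionals lie in the dual ball
  and are admissible in the injective norm.\<close>

lemma nuclear_representation:
  assumes T: "linear_map T" and e: "e > 0"
  shows "\<exists>(m::nat) g y. (\<forall>i<m. g i \<in> dual_ball sX nX) \<and> (\<forall>x. T x = (\<Sum>i<m. sY (g i x) (y i))) \<and>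
    (\<Sum>i<m. nY (y i)) < nuclear_norm sX nX sY nY T + e"
proof -
  let ?S = "{\<Sum>i<m. nY (y i) * dual_norm nX (f i) | (m::nat) (f :: nat \<Rightarrow> 'a \<Rightarrow> 'k) (y :: nat \<Rightarrow> 'b).
      (\<forall>i<m. f i \<in> dual_space sX) \<and> (\<forall>x. T x = (\<Sum>i<m. sY (f i x) (y i)))}"
  have "?S \<noteq> {}" by (rule nuclear_values_nonempty[OF T])
  moreover have "Inf ?S < nuclear_norm sX nX sY nY T + e"
    using e by (simp add: nuclear_norm_def)
  ultimately obtain t where "t \<in> ?S" and t: "t < nuclear_norm sX nX sY nY T + e"
    using cInf_lessD[of ?S] by blast
  then obtain m :: nat and f and y where f: "\<And>i. i < m \<Longrightarrow> f i \<in> dual_space sX"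
    and rep: "\<And>x. T x = (\<Sum>i<m. sY (f i x) (y i))" and tm: "t = (\<Sum>i<m. nY (y i) * dual_norm nX (f i))"
    by blast
  have "\<exists>h. h \<in> dual_ball sX nX \<and> (\<forall>x. f i x = of_real (dual_norm nX (f i)) * h x)" if "i < m" for i
    by (rule X.normalize_functional[OF f[OF that]]) blast
  then obtain g where g: "\<And>i. i < m \<Longrightarrow> g i \<in> dual_ball sX nX"
    "\<And>i x. i < m \<Longrightarrow> f i x = of_real (dual_norm nX (f i)) * g i x"
    by metis
  let ?y = "\<lambda>i. sY (of_real (dual_norm nX (f i))) (y i)"
  have "T x = (\<Sum>i<m. sY (g i x) (?y i))" for x
    unfolding rep
  proof (rule sum.cong[OF refl])
    fix i assume "i \<in> {..<m}"
    then have "f i x = of_real (dual_norm nX (f i)) * g i x" using g(2) by blast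
    from arg_cong[OF this, of "\<lambda>c. sY c (y i)"]
    show "sY (f i x) (y i) = sY (g i x) (?y i)" by (simp add: mult.commute)
  qed
  moreover have "(\<Sum>i<m. nY (?y i)) = t"
    unfolding tm using f by (intro sum.cong refl) (simp add: Y.nrm_scale X.dual_norm_ge_0)
  ultimately show ?thesis
    using t by (intro exI[of _ m] exI[of _ g] exI[of _ ?y] conjI allI impI g(1)) simp_all
qed

lemma nuclear_norm_triangle:
  assumes S: "linear_map S" and T: "linear_map T"
  shows "nuclear_norm sX nX sY nY (S + T) \<le> nuclear_norm sX nX sY nY S + nuclear_norm sX nX sY nY T"
proof (rule field_le_epsilon)
  fix e :: real assume "e > 0"
  then have e2: "e / 2 > 0" by simp
  obtain m :: nat and g :: "nat \<Rightarrow> 'a \<Rightarrow> 'k" and y where g: "\<And>i. i < m \<Longrightarrow> g i \<in> dual_ball sX nX"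
    "\<And>x. S x = (\<Sum>i<m. sY (g i x) (y i))" "(\<Sum>i<m. nY (y i)) < nuclear_norm sX nX sY nY S + e / 2"
    using nuclear_representation[OF S e2] by blast
  obtain l :: nat and h :: "nat \<Rightarrow> 'a \<Rightarrow> 'k" and u where h: "\<And>i. i < l \<Longrightarrow> h i \<in> dual_ball sX nX"
    "\<And>x. T x = (\<Sum>i<l. sY (h i x) (u i))" "(\<Sum>i<l. nY (u i)) < nuclear_norm sX nX sY nY T + e / 2"
    using nuclear_representation[OF T e2] by blast
  let ?g = "\<lambda>i. if i < m then g i else h (i - m)" and ?y = "\<lambda>i. if i < m then y i else u (i - m)"
  \<comment> \<open>Concatenation of the two representations. \<open>F\<close> is polymorphic, being
    used with values in \<open>'b\<close> and in the reals.\<close>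
  have split: "(\<Sum>i<m + l. F (?g i) (?y i)) = (\<Sum>i<m. F (g i) (y i)) + (\<Sum>i<l. F (h i) (u i))"
    for F :: "('a \<Rightarrow> 'k) \<Rightarrow> 'b \<Rightarrow> 'c::comm_monoid_add"
    by (induction l) (auto simp: add.assoc)
  have "nuclear_norm sX nX sY nY (S + T) \<le> (\<Sum>i<m + l. nY (?y i))"
  proof (rule nuclear_norm_le_dual_ball)
    show "(S + T) x = (\<Sum>i<m + l. sY (?g i x) (?y i))" for x
      unfolding split[of "\<lambda>g y. sY (g x) y"] by (simp add: g(2) h(2))
  qed (use g(1) h(1) in auto)
  also have "\<dots> = (\<Sum>i<m. nY (y i)) + (\<Sum>i<l. nY (u i))"
    by (rule split)
  finally show "nuclear_norm sX nX sY nY (S + T) \<le>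
      nuclear_norm sX nX sY nY S + nuclear_norm sX nX sY nY T + e"
    using g(3) h(3) by simp
qed

lemma linear_map_scale:
  assumes "linear_map T"
  shows "linear_map (\<lambda>x. sY c (T x))"
  using assms by (simp add: linear_map_iff Y.scale_right_distrib mult.commute)

lemma nuclear_norm_scale_le:
  assumes T: "linear_map T"
  shows "nuclear_norm sX nX sY nY (\<lambda>x. sY c (T x)) \<le> norm c * nuclear_norm sX nX sY nY T"
proof -
  have "nuclear_norm sX nX sY nY (\<lambda>x. sY c (T x)) \<le> norm c * (nuclear_norm sX nX sY nY T + e)"
    if e: "e > 0" for e
  proof -
    obtain m :: nat and g :: "nat \<Rightarrow> 'a \<Rightarrow> 'k" and y where g: "\<And>i. i < m \<Longrightarrow> g i \<in> dual_ball sX nX"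
      "\<And>x. T x = (\<Sum>i<m. sY (g i x) (y i))" "(\<Sum>i<m. nY (y i)) < nuclear_norm sX nX sY nY T + e"
      using nuclear_representation[OF T e] by blast
    have "nuclear_norm sX nX sY nY (\<lambda>x. sY c (T x)) \<le> (\<Sum>i<m. nY (sY c (y i)))"
      by (rule nuclear_norm_le_dual_ball[OF g(1)])
        (auto simp: g(2) Y.scale_sum_right mult.commute)
    also have "\<dots> = norm c * (\<Sum>i<m. nY (y i))" by (simp add: Y.nrm_scale sum_distrib_left)
    also have "\<dots> \<le> norm c * (nuclear_norm sX nX sY nY T + e)"
      using g(3) by (intro mult_left_mono) auto
    finally show ?thesis .
  qed
  then have *: "nuclear_norm sX nX sY nY (\<lambda>x. sY c (T x)) \<le> norm c * nuclear_norm sX nX sY nY T + norm c * e"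
    if "e > 0" for e using that by (simp add: distrib_left)
  show ?thesis
  proof (cases "c = 0")
    case False
    show ?thesis
      by (rule field_le_epsilon) (use *[of "_ / norm c"] False in auto)
  qed (use *[of 1] in simp)
qed

lemma nuclear_norm_scale:
  assumes T: "linear_map T"
  shows "nuclear_norm sX nX sY nY (\<lambda>x. sY c (T x)) = norm c * nuclear_norm sX nX sY nY T"
proof (cases "c = 0")
  case True
  then show ?thesis
    using nuclear_norm_scale_le[OF T, of c] nuclear_norm_ge_0[OF linear_map_scale[OF T], of c] by simp
next
  case False
  then have "nuclear_norm sX nX sY nY T \<le> norm (1 / c) * nuclear_norm sX nX sY nY (\<lambda>x. sY c (T x))"
    using nuclear_norm_scale_le[OF linear_map_scale[OF T], of "1 / c" c] by simp
  with False show ?thesis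
    using nuclear_norm_scale_le[OF T, of c] by (simp add: norm_divide field_simps)
qed


section \<open>The space of operators and a norming functional on it\<close>

lemma linear_map_rank_one:
  assumes "f \<in> dual_space sX"
  shows "linear_map (\<lambda>x. sY (f x) y)"
  using assms by (simp add: linear_map_iff X.dual_space_iff Y.scale_left_distrib)

lemma linear_map_add:
  assumes "linear_map S" "linear_map T"
  shows "linear_map (S + T)"
  using assms by (simp add: linear_map_iff Y.scale_right_distrib algebra_simps)

lemma linear_map_zero: "linear_map 0"
  by (simp add: linear_map_iff)

text \<open>Supplies the finite spanning set for the Hahn-Banach argument on operators: the rank-one
  maps built from coordinate functionals of \<open>X\<close> and a spanning family of
  \<open>Y\<close>.\<close>

lemma linear_maps_finite_span:
  obtains B where "finite B" "module.span (\<lambda>c (T :: 'a \<Rightarrow> 'b) x. sY c (T x)) B = {T. linear_map T}"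
proof -
  interpret L: vector_space "\<lambda>c (T :: 'a \<Rightarrow> 'b) x. sY c (T x)"
    using vector_space_pointwise[OF Y.vector_space_axioms] .
  obtain n and v :: "nat \<Rightarrow> 'a" and f :: "nat \<Rightarrow> 'a \<Rightarrow> 'k" where
    f: "\<And>i. i < n \<Longrightarrow> f i \<in> dual_space sX" and v: "\<And>x. x = (\<Sum>i<n. sX (f i x) (v i))"
    using X.exists_bounded_basis by blast
  obtain m and u :: "nat \<Rightarrow> 'b" and h :: "nat \<Rightarrow> 'b \<Rightarrow> 'k" where
    u: "\<And>y. y = (\<Sum>j<m. sY (h j y) (u j))"
    using Y.exists_bounded_basis by blast
  define B where "B = (\<lambda>(i, j) x. sY (f i x) (u j)) ` ({..<n} \<times> {..<m})"
  have "linear_map T" if "T \<in> L.span B" for T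
    using that
  proof (induction rule: L.span_induct_alt)
    case base
    show ?case by (rule linear_map_zero)
  next
    case (step c S T)
    then have "linear_map S" by (auto simp: B_def intro: linear_map_rank_one f)
    then show ?case by (intro linear_map_add linear_map_scale step)
  qed
  moreover have "T \<in> L.span B" if T: "linear_map T" for T
  proof -
    have "T = (\<Sum>i<n. \<Sum>j<m. (\<lambda>x. sY (h j (T (v i))) (sY (f i x) (u j))))"
    proof
      fix x
      have "(\<Sum>i\<in>I. F i) x = (\<Sum>i\<in>I. F i x)" for I :: "nat set" and F :: "nat \<Rightarrow> 'a \<Rightarrow> 'b"
        by (induction I rule: infinite_finite_induct) auto
      then have "(\<Sum>i<n. \<Sum>j<m. (\<lambda>x. sY (h j (T (v i))) (sY (f i x) (u j)))) x =
          (\<Sum>i<n. \<Sum>j<m. sY (f i x) (sY (h j (T (v i))) (u j)))"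
        by (simp add: mult.commute)
      also have "\<dots> = (\<Sum>i<n. sY (f i x) (\<Sum>j<m. sY (h j (T (v i))) (u j)))"
        by (simp only: Y.scale_sum_right)
      also have "\<dots> = (\<Sum>i<n. sY (f i x) (T (v i)))"
        by (simp only: u[symmetric])
      also have "\<dots> = T x"
        by (rule trans[OF arg_cong[OF v[of x], of T] linear_map_sum[OF T], symmetric])
      finally show "T x = (\<Sum>i<n. \<Sum>j<m. (\<lambda>x. sY (h j (T (v i))) (sY (f i x) (u j)))) x" ..
    qed
    also have "\<dots> \<in> L.span B"
      by (intro L.span_sum L.span_scale L.span_base) (auto simp: B_def)
    finally show ?thesis .
  qed
  moreover have "finite B" by (simp add: B_def)
  ultimately show ?thesis by (intro that[of B]) auto
qed

text \<open>
  \<open>\<phi> f y\<close> is the value on \<open>f \<otimes> y\<close> of a norming functional for \<open>T\<close> in the dual of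
  the space of operators with the nuclear norm.
\<close>

definition norming_pairing :: "('a \<Rightarrow> 'b) \<Rightarrow> (('a \<Rightarrow> 'k) \<Rightarrow> 'b \<Rightarrow> 'k) \<Rightarrow> bool" where
  "norming_pairing T \<phi> \<longleftrightarrow>
    (\<forall>f\<in>dual_space sX. \<phi> f \<in> dual_space sY) \<and>
    (\<forall>(n::nat) f a y. (\<forall>i<n. f i \<in> dual_space sX) \<longrightarrow> \<phi> (\<lambda>x. \<Sum>i<n. a i * f i x) y = (\<Sum>i<n. a i * \<phi> (f i) y)) \<and>
    (\<forall>f\<in>dual_space sX. \<forall>y. norm (\<phi> f y) \<le> nY y * dual_norm nX f) \<and>
    (\<forall>(n::nat) f y. (\<forall>i<n. f i \<in> dual_space sX) \<longrightarrow> (\<forall>x. T x = (\<Sum>i<n. sY (f i x) (y i))) \<longrightarrow>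
      (\<Sum>i<n. \<phi> (f i) (y i)) = of_real (nuclear_norm sX nX sY nY T))"

text \<open>The pairing is the norming functional restricted to rank-one operators. These have
  nuclear norm at most \<open>nY y * dual_norm nX f\<close>, and every representation of
  \<open>T\<close> splits \<open>\<Phi> T\<close> into a sum of values of the pairing.\<close>

lemma exists_norming_pairing:
  assumes T: "linear_map T"
  shows "\<exists>\<phi>. norming_pairing T \<phi>"
proof -
  let ?s = "\<lambda>c (T :: 'a \<Rightarrow> 'b) x. sY c (T x)" and ?N = "nuclear_norm sX nX sY nY"
  obtain B where B: "finite B" "module.span ?s B = {T. linear_map T}"
    by (rule linear_maps_finite_span)
  obtain \<Phi> :: "('a \<Rightarrow> 'b) \<Rightarrow> 'k" where
    add: "\<And>S S'. linear_map S \<Longrightarrow> linear_map S' \<Longrightarrow> \<Phi> (S + S') = \<Phi> S + \<Phi> S'" and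
    scale: "\<And>c S. linear_map S \<Longrightarrow> \<Phi> (\<lambda>x. sY c (S x)) = c * \<Phi> S" and
    PhiT: "\<Phi> T = of_real (?N T)" and
    le: "\<And>S. linear_map S \<Longrightarrow> norm (\<Phi> S) \<le> ?N S"
    by (rule X.Hahn_Banach_finite_span[OF vector_space_pointwise[OF Y.vector_space_axioms] B(1) B(2)[symmetric], of ?N T])
      (auto simp: nuclear_norm_triangle nuclear_norm_scale T)
  define \<phi> where "\<phi> f y = \<Phi> (\<lambda>x. sY (f x) y)" for f y
  have Phi0: "\<Phi> (\<lambda>x. 0) = 0"
    using scale[OF linear_map_zero, of 0] by (simp add: zero_fun_def)
  have Phi_sum: "linear_map (\<lambda>x. \<Sum>i<n. S i x) \<and> \<Phi> (\<lambda>x. \<Sum>i<n. S i x) = (\<Sum>i<n. \<Phi> (S i))"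
    if "\<And>i. i < n \<Longrightarrow> linear_map (S i)" for n :: nat and S
    using that
  proof (induction n)
    case 0
    then show ?case using linear_map_zero by (simp add: Phi0 zero_fun_def)
  next
    case (Suc n)
    have eq: "(\<lambda>x. \<Sum>i<Suc n. S i x) = (\<lambda>x. \<Sum>i<n. S i x) + S n"
      by (simp add: fun_eq_iff)
    have "linear_map (\<lambda>x. \<Sum>i<n. S i x)" "\<Phi> (\<lambda>x. \<Sum>i<n. S i x) = (\<Sum>i<n. \<Phi> (S i))" "linear_map (S n)"
      using Suc by auto
    then show ?case unfolding eq using add linear_map_add by simp
  qed
  have "\<phi> f \<in> dual_space sY" if f: "f \<in> dual_space sX" for f
  proof -
    have "(\<lambda>x. sY (f x) (y + y')) = (\<lambda>x. sY (f x) y) + (\<lambda>x. sY (f x) y')" for y y'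
      by (simp add: fun_eq_iff Y.scale_right_distrib)
    moreover have "(\<lambda>x. sY (f x) (sY c y)) = (\<lambda>x. sY c (sY (f x) y))" for c y
      by (simp add: fun_eq_iff mult.commute)
    ultimately show ?thesis
      unfolding Y.dual_space_iff \<phi>_def
      by (simp only: add[OF linear_map_rank_one[OF f] linear_map_rank_one[OF f]] scale[OF linear_map_rank_one[OF f]]) simp
  qed
  moreover have "\<phi> (\<lambda>x. \<Sum>i<n. a i * f i x) y = (\<Sum>i<n. a i * \<phi> (f i) y)"
    if f: "\<forall>i<n. f i \<in> dual_space sX" for n :: nat and f a y
  proof -
    have "\<phi> (\<lambda>x. \<Sum>i<n. a i * f i x) y = \<Phi> (\<lambda>x. \<Sum>i<n. sY (a i) (sY (f i x) y))"
      by (simp add: \<phi>_def Y.scale_sum_left)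
    also have "\<dots> = (\<Sum>i<n. \<Phi> (\<lambda>x. sY (a i) (sY (f i x) y)))"
      by (rule conjunct2[OF Phi_sum]) (use f in \<open>auto intro!: linear_map_scale linear_map_rank_one simp del: Y.scale_scale\<close>)
    also have "\<dots> = (\<Sum>i<n. a i * \<phi> (f i) y)"
      unfolding \<phi>_def using f by (intro sum.cong refl scale linear_map_rank_one) auto
    finally show ?thesis .
  qed
  moreover have "norm (\<phi> f y) \<le> nY y * dual_norm nX f" if f: "f \<in> dual_space sX" for f y
  proof -
    have "norm (\<phi> f y) \<le> ?N (\<lambda>x. sY (f x) y)"
      unfolding \<phi>_def by (rule le[OF linear_map_rank_one[OF f]])
    also have "\<dots> \<le> (\<Sum>i<1::nat. nY y * dual_norm nX f)"
      by (rule nuclear_norm_le[of 1 "\<lambda>_. f" _ "\<lambda>_. y"]) (use f in auto)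
    finally show ?thesis by simp
  qed
  moreover have "(\<Sum>i<n. \<phi> (f i) (y i)) = of_real (?N T)"
    if f: "\<forall>i<n. f i \<in> dual_space sX" and rep: "\<forall>x. T x = (\<Sum>i<n. sY (f i x) (y i))" for n :: nat and f y
  proof -
    have "(\<Sum>i<n. \<phi> (f i) (y i)) = \<Phi> (\<lambda>x. \<Sum>i<n. sY (f i x) (y i))"
      unfolding \<phi>_def by (rule conjunct2[OF Phi_sum, symmetric]) (use f in \<open>auto intro!: linear_map_rank_one\<close>)
    also have "(\<lambda>x. \<Sum>i<n. sY (f i x) (y i)) = T" using rep by (simp add: fun_eq_iff)
    finally show ?thesis by (simp add: PhiT)
  qed
  ultimately have "norming_pairing T \<phi>"
    unfolding norming_pairing_def by (intro conjI ballI allI impI)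
  then show ?thesis by (intro exI[of _ \<phi>])
qed

subsection \<open>Factoring the norming functional through a Euclidean space\<close>

text \<open>
  The operator \<open>y \<mapsto> \<Sum>\<^sub>i g\<^sub>i(y) x\<^sub>i\<close> from \<open>Y\<close> to \<open>X\<close> factors through \<open>\<ell>\<^sub>2\<^sup>n\<close> with norm at most \<open>1\<close>,
  and the trace of its composition with \<open>T\<close> is \<open>t\<close>.
\<close>

definition trace_through_l2 :: "('a \<Rightarrow> 'b) \<Rightarrow> real \<Rightarrow> nat \<Rightarrow> (nat \<Rightarrow> 'a) \<Rightarrow> (nat \<Rightarrow> 'b \<Rightarrow> 'k) \<Rightarrow> bool" where
  "trace_through_l2 T t n x g \<longleftrightarrow>
     (\<forall>i<n. g i \<in> dual_space sY) \<and>
     (\<forall>h\<in>dual_ball sX nX. (\<Sum>i<n. (norm (h (x i)))\<^sup>2) \<le> 1) \<and>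
     (\<forall>y. (\<Sum>i<n. (norm (g i y))\<^sup>2) \<le> (nY y)\<^sup>2) \<and>
     (\<Sum>i<n. g i (T (x i))) = of_real t"

text \<open>The orthonormal basis itself serves as the \<open>x i\<close>, and the pairing sends its
  coordinate functionals to functionals on \<open>Y\<close>. Each of the two bounds is a square sum
  tested against its own conjugate coefficients.\<close>

lemma trace_through_l2_domain:
  assumes T: "linear_map T" and eucl: "euclidean_norm cj sX nX"
  shows "\<exists>n x g. trace_through_l2 T (nuclear_norm sX nX sY nY T) n x g"
proof -
  obtain \<phi> where \<phi>: "norming_pairing T \<phi>"
    using exists_norming_pairing[OF T] by (rule exE)
  note dual = \<phi>[unfolded norming_pairing_def, THEN conjunct1]
    and lin = \<phi>[unfolded norming_pairing_def, THEN conjunct2, THEN conjunct1]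
    and le = \<phi>[unfolded norming_pairing_def, THEN conjunct2, THEN conjunct2, THEN conjunct1]
    and trace = \<phi>[unfolded norming_pairing_def, THEN conjunct2, THEN conjunct2, THEN conjunct2]
  obtain n and e :: "nat \<Rightarrow> 'a" and f :: "nat \<Rightarrow> 'a \<Rightarrow> 'k" where
    f: "\<forall>i<n. f i \<in> dual_space sX" and
    biorth: "\<forall>i<n. \<forall>j<n. f i (e j) = (if i = j then 1 else 0)" and
    expand: "\<forall>v. v = (\<Sum>i<n. sX (f i v) (e i))" and
    parseval: "\<forall>v. (nX v)\<^sup>2 = (\<Sum>i<n. (norm (f i v))\<^sup>2)"
    using X.exists_orthonormal_basis[OF eucl] by blast
  have "(\<Sum>i<n. (norm (h (e i)))\<^sup>2) \<le> 1" if h: "h \<in> dual_ball sX nX" for h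
  proof -
    have hd: "h \<in> dual_space sX" using h by (simp add: dual_ball_def)
    define S where "S = (\<Sum>i<n. (norm (h (e i)))\<^sup>2)"
    \<comment> \<open>The Riesz vector of \<open>h\<close> in the orthonormal basis:
      \<open>h v = S\<close> while \<open>v\<close> has norm \<open>sqrt S\<close>.\<close>
    define v where "v = (\<Sum>i<n. sX (cj (h (e i))) (e i))"
    have fv: "f j v = cj (h (e j))" if j: "j < n" for j
    proof -
      have "f j v = (\<Sum>i<n. cj (h (e i)) * f j (e i))"
        using f j by (simp add: v_def X.dual_sum X.dual_scale)
      also have "\<dots> = (\<Sum>i<n. if i = j then cj (h (e i)) else 0)"
        using biorth j by (intro sum.cong refl) auto
      finally show ?thesis using j by simp
    qed
    have "(nX v)\<^sup>2 = S"
      unfolding parseval[rule_format] S_def by (intro sum.cong refl) (simp add: fv X.norm_cj)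
    then have nv: "nX v = sqrt S" by (metis X.nrm_ge_0 real_sqrt_unique)
    have S0: "S \<ge> 0" unfolding S_def by (intro sum_nonneg) simp
    have "h v = (\<Sum>i<n. h (e i) * cj (h (e i)))"
      by (simp add: v_def X.dual_sum[OF hd] X.dual_scale[OF hd] mult.commute)
    also have "\<dots> = of_real S"
      by (simp only: X.mult_cj S_def of_real_sum)
    finally have "norm (h v) = S" using S0 by simp
    then have "S \<le> 1 * sqrt S" using X.norm_dual_ball_le[OF h, of v] nv by simp
    from le_square_of_le_mult_sqrt[OF S0 this] show ?thesis by (simp add: S_def)
  qed
  moreover have "(\<Sum>i<n. (norm (\<phi> (f i) y))\<^sup>2) \<le> (nY y)\<^sup>2" for y
  proof -
    define S where "S = (\<Sum>i<n. (norm (\<phi> (f i) y))\<^sup>2)"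
    \<comment> \<open>Conjugate coefficients give \<open>\<phi> h y = S\<close>, and by
      Cauchy-Schwarz the dual norm of \<open>h\<close> is at most \<open>sqrt S\<close>.\<close>
    define h where "h x = (\<Sum>i<n. cj (\<phi> (f i) y) * f i x)" for x
    have S0: "S \<ge> 0" unfolding S_def by (intro sum_nonneg) simp
    have hd: "h \<in> dual_space sX"
      unfolding h_def by (rule X.dual_space_lincomb) (use f in auto)
    have "\<phi> h y = (\<Sum>i<n. cj (\<phi> (f i) y) * \<phi> (f i) y)"
      unfolding h_def by (rule lin[rule_format]) (use f in auto)
    also have "\<dots> = (\<Sum>i<n. of_real ((norm (\<phi> (f i) y))\<^sup>2))"
      by (intro sum.cong refl) (simp only: X.mult_cj[symmetric] mult.commute)
    also have "\<dots> = of_real S" by (simp only: S_def of_real_sum)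
    finally have phi: "norm (\<phi> h y) = S" using S0 by simp
    have "norm (h x) \<le> sqrt S * nX x" for x
    proof -
      have "norm (h x) \<le> sqrt (\<Sum>i<n. (norm (cj (\<phi> (f i) y)))\<^sup>2) * sqrt (\<Sum>i<n. (norm (f i x))\<^sup>2)"
        unfolding h_def by (rule X.Cauchy_Schwarz_norm)
      also have "\<dots> = sqrt S * nX x"
        by (simp add: X.norm_cj S_def parseval[rule_format, symmetric])
      finally show ?thesis .
    qed
    then have "dual_norm nX h \<le> sqrt S"
      using S0 by (intro X.dual_norm_le) auto
    then have "S \<le> nY y * sqrt S"
      using le[rule_format, OF hd, of y] phi mult_left_mono[of "dual_norm nX h" "sqrt S" "nY y"] by simp
    from le_square_of_le_mult_sqrt[OF S0 this] show ?thesis by (simp add: S_def)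
  qed
  moreover have "(\<Sum>i<n. \<phi> (f i) (T (e i))) = of_real (nuclear_norm sX nX sY nY T)"
  proof (rule trace[rule_format])
    fix x show "T x = (\<Sum>i<n. sY (f i x) (T (e i)))"
      by (rule trans[OF arg_cong[OF spec[OF expand, of x], of T] linear_map_sum[OF T]])
  qed (use f in auto)
  moreover have "\<forall>i<n. \<phi> (f i) \<in> dual_space sY" using f dual by blast
  ultimately show ?thesis
    by (intro exI[of _ n] exI[of _ e] exI[of _ "\<lambda>i. \<phi> (f i)"]) (simp add: trace_through_l2_def)
qed

text \<open>Here the coordinate functionals of \<open>Y\<close> are the \<open>g i\<close>, with
  their bound given by Parseval, and the pairing enters in the \<open>x i\<close>. The trace is
  computed from the representation of \<open>T\<close> by the functionals
  \<open>\<lambda>x. f i (T x)\<close> and the basis \<open>e i\<close>.\<close>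

lemma trace_through_l2_codomain:
  assumes T: "linear_map T" and eucl: "euclidean_norm cj sY nY"
  shows "\<exists>n x g. trace_through_l2 T (nuclear_norm sX nX sY nY T) n x g"
proof -
  obtain \<phi> where \<phi>: "norming_pairing T \<phi>"
    using exists_norming_pairing[OF T] by (rule exE)
  note dual = \<phi>[unfolded norming_pairing_def, THEN conjunct1]
    and lin = \<phi>[unfolded norming_pairing_def, THEN conjunct2, THEN conjunct1]
    and le = \<phi>[unfolded norming_pairing_def, THEN conjunct2, THEN conjunct2, THEN conjunct1]
    and trace = \<phi>[unfolded norming_pairing_def, THEN conjunct2, THEN conjunct2, THEN conjunct2]
  obtain n and e :: "nat \<Rightarrow> 'b" and f :: "nat \<Rightarrow> 'b \<Rightarrow> 'k" where
    f: "\<forall>i<n. f i \<in> dual_space sY" and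
    biorth: "\<forall>i<n. \<forall>j<n. f i (e j) = (if i = j then 1 else 0)" and
    expand: "\<forall>v. v = (\<Sum>i<n. sY (f i v) (e i))" and
    parseval: "\<forall>v. (nY v)\<^sup>2 = (\<Sum>i<n. (norm (f i v))\<^sup>2)"
    using Y.exists_orthonormal_basis[OF eucl] by blast
  obtain m :: nat and v :: "nat \<Rightarrow> 'a" and u :: "nat \<Rightarrow> 'a \<Rightarrow> 'k" where
    u: "\<forall>b<m. u b \<in> dual_space sX" and v: "\<forall>x. x = (\<Sum>b<m. sX (u b x) (v b))"
    using X.exists_bounded_basis by blast
  \<comment> \<open>\<open>x i\<close> is the vector of \<open>X\<close> that represents the element
    \<open>h \<mapsto> \<phi> h (e i)\<close> of the bidual, written out in a basis.\<close>
  define x where "x i = (\<Sum>b<m. sX (\<phi> (u b) (e i)) (v b))" for i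
  have hx: "h (x i) = \<phi> h (e i)" if h: "h \<in> dual_space sX" for h i
  proof -
    have "h = (\<lambda>x. \<Sum>b<m. h (v b) * u b x)"
    proof
      fix x
      have "h x = h (\<Sum>b<m. sX (u b x) (v b))" by (rule arg_cong[OF spec[OF v]])
      then show "h x = (\<Sum>b<m. h (v b) * u b x)"
        by (simp add: X.dual_sum[OF h] X.dual_scale[OF h] mult.commute)
    qed
    then have "\<phi> h (e i) = \<phi> (\<lambda>x. \<Sum>b<m. h (v b) * u b x) (e i)" by (rule arg_cong)
    also have "\<dots> = (\<Sum>b<m. h (v b) * \<phi> (u b) (e i))" by (rule lin[rule_format]) (use u in auto)
    finally show ?thesis by (simp add: x_def X.dual_sum[OF h] X.dual_scale[OF h] mult.commute)
  qed
  have "(\<Sum>i<n. (norm (h (x i)))\<^sup>2) \<le> 1" if h: "h \<in> dual_ball sX nX" for h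
  proof -
    have hd: "h \<in> dual_space sX" and h1: "dual_norm nX h \<le> 1" using h by (simp_all add: dual_ball_def)
    define S where "S = (\<Sum>i<n. (norm (h (x i)))\<^sup>2)"
    define z where "z = (\<Sum>i<n. sY (cj (h (x i))) (e i))"
    have fz: "f j z = cj (h (x j))" if j: "j < n" for j
    proof -
      have "f j z = (\<Sum>i<n. cj (h (x i)) * f j (e i))"
        using f j by (simp add: z_def Y.dual_sum Y.dual_scale)
      also have "\<dots> = (\<Sum>i<n. if i = j then cj (h (x i)) else 0)"
        using biorth j by (intro sum.cong refl) auto
      finally show ?thesis using j by simp
    qed
    have "(nY z)\<^sup>2 = S"
      unfolding parseval[rule_format] S_def by (intro sum.cong refl) (simp add: fz X.norm_cj)
    then have nz: "nY z = sqrt S" by (metis Y.nrm_ge_0 real_sqrt_unique)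
    have S0: "S \<ge> 0" unfolding S_def by (intro sum_nonneg) simp
    have "\<phi> h z = (\<Sum>i<n. h (x i) * cj (h (x i)))"
      by (simp add: z_def Y.dual_sum[OF dual[rule_format, OF hd]] Y.dual_scale[OF dual[rule_format, OF hd]] hx[OF hd] mult.commute)
    also have "\<dots> = of_real S"
      by (simp only: X.mult_cj S_def of_real_sum)
    finally have "norm (\<phi> h z) = S" using S0 by simp
    then have "S \<le> 1 * sqrt S"
      using le[rule_format, OF hd, of z] nz mult_left_mono[OF h1, of "sqrt S"] S0 by simp
    from le_square_of_le_mult_sqrt[OF S0 this] show ?thesis by (simp add: S_def)
  qed
  moreover have "(\<Sum>i<n. f i (T (x i))) = of_real (nuclear_norm sX nX sY nY T)"
  proof -
    have fT: "(\<lambda>x. f i (T x)) \<in> dual_space sX" if "i < n" for i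
      using dual_comp_linear_map[OF T] f that by blast
    have "(\<Sum>i<n. f i (T (x i))) = (\<Sum>i<n. \<phi> (\<lambda>x. f i (T x)) (e i))"
      using hx[OF fT] by (intro sum.cong refl) auto
    also have "\<dots> = of_real (nuclear_norm sX nX sY nY T)"
      by (rule trace[rule_format]) (use fT expand in auto)
    finally show ?thesis .
  qed
  ultimately show ?thesis
    using f by (intro exI[of _ n] exI[of _ x] exI[of _ f]) (simp add: trace_through_l2_def parseval[rule_format])
qed

subsection \<open>The lower bound\<close>

text \<open>Homogeneity in each slot reduces to normalized arguments, whose coordinate vectors lie
  in the Euclidean ball. An argument of norm 0 is the zero vector, where the \<open>g i\<close> and
  their quotients by 0 all vanish.\<close>

lemma sign_form_le_of_bounds:
  assumes M: "\<forall>a. (\<forall>j<k. (\<Sum>i<n. (norm (a j i))\<^sup>2) \<le> 1) \<longrightarrow> norm (X.sign_form n k e a) \<le> M"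
    and g: "\<And>i. i < n \<Longrightarrow> g i \<in> dual_space sY"
    and l2: "\<And>y. (\<Sum>i<n. (norm (g i y))\<^sup>2) \<le> (nY y)\<^sup>2"
  shows "norm (X.sign_form n k e (\<lambda>j i. g i (ys ! j))) \<le> M * (\<Prod>j<k. nY (ys ! j))"
proof -
  let ?a = "\<lambda>j i. g i (ys ! j) / of_real (nY (ys ! j))"
  have ball: "(\<Sum>i<n. (norm (?a j i))\<^sup>2) \<le> 1" for j
  proof (cases "nY (ys ! j) = 0")
    case False
    then have pos: "(nY (ys ! j))\<^sup>2 > 0" by simp
    have "(\<Sum>i<n. (norm (?a j i))\<^sup>2) = (\<Sum>i<n. (norm (g i (ys ! j)))\<^sup>2) / (nY (ys ! j))\<^sup>2"
      by (simp add: norm_divide power_divide sum_divide_distrib)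
    also have "\<dots> \<le> 1" using l2[of "ys ! j"] pos by (simp add: divide_le_eq_1)
    finally show ?thesis .
  qed simp
  have le: "norm (X.sign_form n k e ?a) \<le> M" by (intro M[rule_format] ball)
  have "X.sign_form n k e (\<lambda>j i. g i (ys ! j)) = X.sign_form n k e (\<lambda>j i. of_real (nY (ys ! j)) * ?a j i)"
  proof (rule X.sign_form_cong)
    fix i j assume "i < n"
    then show "g i (ys ! j) = of_real (nY (ys ! j)) * ?a j i"
      using Y.dual_0[OF g] by (cases "nY (ys ! j) = 0") (auto simp: Y.nrm_eq_0_iff)
  qed
  also have "\<dots> = (\<Prod>j<k. of_real (nY (ys ! j))) * X.sign_form n k e ?a"
    by (rule X.sign_form_mult_slots)
  finally have "norm (X.sign_form n k e (\<lambda>j i. g i (ys ! j))) =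
      norm (\<Prod>j<k. of_real (nY (ys ! j)) :: 'k) * norm (X.sign_form n k e ?a)"
    by (simp only: norm_mult)
  moreover have "norm (\<Prod>j<k. of_real (nY (ys ! j)) :: 'k) = (\<Prod>j<k. nY (ys ! j))"
    by (simp flip: prod_norm)
  moreover have "(\<Prod>j<k. nY (ys ! j)) \<ge> 0" by (intro prod_nonneg) simp
  ultimately show ?thesis
    using mult_left_mono[OF le] by (simp only: mult.commute[of M])
qed

lemma multilinear_sign_form:
  assumes g: "\<And>i. i < n \<Longrightarrow> g i \<in> dual_space sY"
  shows "multilinear_form sY k (\<lambda>ys. X.sign_form n k e (\<lambda>j i. g i (ys ! j)))"
  unfolding multilinear_form_def
proof (intro allI impI)
  fix ys :: "'b list" and r assume ys: "length ys = k" and r: "r < k"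
  let ?c = "\<lambda>i. X.sign_form n k e ((\<lambda>j i. g i (ys ! j))(r := (\<lambda>l. if l = i then 1 else 0)))"
  have eq: "(\<lambda>y. X.sign_form n k e (\<lambda>j i. g i (ys[r := y] ! j))) = (\<lambda>y. \<Sum>i<n. ?c i * g i y)"
  proof
    fix y
    have "(\<lambda>j i. g i (ys[r := y] ! j)) = (\<lambda>j i. g i (ys ! j))(r := (\<lambda>i. g i y))"
      using ys r by (auto simp: fun_eq_iff)
    from arg_cong[OF this, of "X.sign_form n k e"]
    show "X.sign_form n k e (\<lambda>j i. g i (ys[r := y] ! j)) = (\<Sum>i<n. ?c i * g i y)"
      by (rule trans[OF _ trans[OF X.sign_form_expand_slot[OF r]]]) (rule sum.cong[OF refl mult.commute])
  qed
  have "(\<lambda>y. \<Sum>i<n. ?c i * g i y) \<in> dual_space sY"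
    by (rule Y.dual_space_lincomb) (use g in auto)
  then show "Vector_Spaces.linear sY (*) (\<lambda>y. X.sign_form n k e (\<lambda>j i. g i (ys[r := y] ! j)))"
    unfolding eq by (simp only: dual_space_def mem_Collect_eq)
qed

lemma exists_tensor_large_ratio:
  assumes T: "linear_map T" and t: "t > 0" and tr: "trace_through_l2 T t n x g" and \<delta>: "0 < \<delta>" "\<delta> < 1"
  shows "\<exists>K>0. \<forall>k\<ge>1. \<exists>z\<in>tensor_power sX k. z \<noteq> 0 \<and>
    projective_norm sY nY k (tensor_map sY k T z) > 0 \<and>
    t ^ k * (1 - \<delta>) ^ (2 * k) * injective_norm sX nX k z \<le>
      K * (real k)\<^sup>2 * projective_norm sY nY k (tensor_map sY k T z)"
proof -
  have g: "\<And>i. i < n \<Longrightarrow> g i \<in> dual_space sY"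
    and hx: "\<And>h. h \<in> dual_ball sX nX \<Longrightarrow> (\<Sum>i<n. (norm (h (x i)))\<^sup>2) \<le> 1"
    and gy: "\<And>y. (\<Sum>i<n. (norm (g i y))\<^sup>2) \<le> (nY y)\<^sup>2"
    and trace: "(\<Sum>i<n. g i (T (x i))) = of_real t"
    using tr unfolding trace_through_l2_def by auto
  obtain K where K: "K > 0" and exists_signs:
    "\<forall>k Q c. k \<ge> 1 \<longrightarrow> c = (\<Sum>I\<in>multi_indices n k. Q I I) \<longrightarrow> c \<ge> 0 \<longrightarrow>
      (\<exists>e. \<exists>M>0. (\<forall>a. (\<forall>j<k. (\<Sum>i<n. (norm (a j i))\<^sup>2) \<le> 1) \<longrightarrow> norm (X.sign_form n k e a) \<le> M) \<and>
        c * M\<^sup>2 * (1 - \<delta>) ^ (2 * k) \<le>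
          K * (real k)\<^sup>2 * (\<Sum>I\<in>multi_indices n k. \<Sum>J\<in>multi_indices n k. e I * e J * Q I J))"
    using X.exists_signs_large_quadratic_form[OF \<delta>, of n] by blast
  have "\<exists>z\<in>tensor_power sX k. z \<noteq> 0 \<and>
    projective_norm sY nY k (tensor_map sY k T z) > 0 \<and>
    t ^ k * (1 - \<delta>) ^ (2 * k) * injective_norm sX nX k z \<le>
      K * (real k)\<^sup>2 * projective_norm sY nY k (tensor_map sY k T z)"
    if k: "k \<ge> 1" for k
  proof -
    let ?L = "multi_indices n k"
    \<comment> \<open>\<open>q I J\<close> is the contribution of a pair of multi-indices to
      \<open>B\<close> at the image of \<open>z\<close>. Its diagonal sum factors into the
      \<open>k\<close>-th power of the trace; real parts are taken because the sign average is
      stated for real coefficients.\<close>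
    define q where "q I J = (\<Prod>j<k. g (J ! j) (T (x (I ! j))))" for I J
    have "(\<Sum>I\<in>?L. re (q I I)) = re (\<Sum>I\<in>?L. q I I)" by (simp add: X.re_sum)
    also have "(\<Sum>I\<in>?L. q I I) = of_real (t ^ k)"
      unfolding q_def by (subst sum_prod_multi_indices[of "\<lambda>j i. g i (T (x i))"]) (simp add: trace)
    finally have tk: "t ^ k = (\<Sum>I\<in>?L. re (q I I))" by (simp only: X.re_of_real)
    obtain e M where M0: "M > 0" and
      M: "\<forall>a. (\<forall>j<k. (\<Sum>i<n. (norm (a j i))\<^sup>2) \<le> 1) \<longrightarrow> norm (X.sign_form n k e a) \<le> M" and
      large: "t ^ k * M\<^sup>2 * (1 - \<delta>) ^ (2 * k) \<le> K * (real k)\<^sup>2 * (\<Sum>I\<in>?L. \<Sum>J\<in>?L. e I * e J * re (q I J))"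
      using exists_signs[rule_format, of k "t ^ k" "\<lambda>I J. re (q I J)", OF k tk zero_le_power[OF less_imp_le[OF t]]]
      by blast
    define z where "z = (\<lambda>A. \<Sum>I\<in>?L. of_real (e I) * elementary_tensor sX k (map x I) A)"
    have z: "z \<in> tensor_power sX k"
      unfolding z_def by (rule sum_elementary_in_tensor_power) (auto simp: length_multi_indices)
    have inj_le: "injective_norm sX nX k z \<le> M"
    proof (rule X.injective_norm_le)
      fix \<phi>s :: "('a \<Rightarrow> 'k) list" assume \<phi>s: "length \<phi>s = k" "set \<phi>s \<subseteq> dual_ball sX nX"
      have "z (functional_tensor \<phi>s) = X.sign_form n k e (\<lambda>j i. (\<phi>s ! j) (x i))"
        unfolding z_def X.sign_form_def X.functional_tensor_elementary_dual_ball[OF \<phi>s]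
        by (intro sum.cong refl) (simp add: length_multi_indices)
      moreover have "(\<Sum>i<n. (norm ((\<phi>s ! j) (x i)))\<^sup>2) \<le> 1" if "j < k" for j
        using \<phi>s that by (intro hx) auto
      ultimately show "norm (z (functional_tensor \<phi>s)) \<le> M" using M by simp
    qed
    define B where "B ys = X.sign_form n k e (\<lambda>j i. g i (ys ! j))" for ys
    have B: "multilinear_form sY k B"
      unfolding B_def by (rule multilinear_sign_form[OF g])
    have Tz: "tensor_map sY k T z A = (\<Sum>I\<in>?L. of_real (e I) * elementary_tensor sY k (map T (map x I)) A)" for A
    proof (cases "multilinear_form sY k A")
      case True
      then show ?thesis
        using multilinear_form_pullback[OF T True]
        by (simp add: tensor_map_def z_def elementary_tensor_def)
    qed (simp add: tensor_map_def elementary_tensor_def)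
    have "norm (B ys) \<le> M * (\<Prod>j<k. nY (ys ! j))" for ys
      unfolding B_def by (rule sign_form_le_of_bounds[OF M g gy])
    then have "norm (tensor_map sY k T z B) \<le> M * projective_norm sY nY k (tensor_map sY k T z)"
      by (intro Y.multilinear_form_le_projective_norm[OF finite_multi_indices _ k Tz B _ M0])
        (simp_all add: length_multi_indices)
    moreover have "re (tensor_map sY k T z B) = (\<Sum>I\<in>?L. \<Sum>J\<in>?L. e I * e J * re (q I J))"
    proof -
      have "tensor_map sY k T z B = (\<Sum>I\<in>?L. of_real (e I) * B (map T (map x I)))"
        unfolding Tz using B by (simp add: elementary_tensor_def)
      also have "\<dots> = (\<Sum>I\<in>?L. \<Sum>J\<in>?L. of_real (e I * e J) * q I J)"
      proof (intro sum.cong refl)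
        fix I assume I: "I \<in> ?L"
        have "B (map T (map x I)) = (\<Sum>J\<in>?L. of_real (e J) * q I J)"
          unfolding B_def X.sign_form_def q_def using length_multi_indices[OF I] by (intro sum.cong refl) simp
        then show "of_real (e I) * B (map T (map x I)) = (\<Sum>J\<in>?L. of_real (e I * e J) * q I J)"
          by (simp add: sum_distrib_left mult.assoc)
      qed
      finally show ?thesis by (simp only: X.re_sum X.re_of_real_mult)
    qed
    ultimately have low: "(\<Sum>I\<in>?L. \<Sum>J\<in>?L. e I * e J * re (q I J)) \<le> M * projective_norm sY nY k (tensor_map sY k T z)"
      using X.abs_re_le[of "tensor_map sY k T z B"] by linarith
    let ?P = "projective_norm sY nY k (tensor_map sY k T z)"
    \<comment> \<open>One of the two factors \<open>M\<close> comes from the bound on the form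
      \<open>B\<close> and cancels; the other is kept to dominate the injective norm of
      \<open>z\<close>.\<close>
    have "M * (t ^ k * (1 - \<delta>) ^ (2 * k) * M) \<le> M * (K * (real k)\<^sup>2 * ?P)"
    proof -
      have "M * (t ^ k * (1 - \<delta>) ^ (2 * k) * M) = t ^ k * M\<^sup>2 * (1 - \<delta>) ^ (2 * k)"
        by (simp add: power2_eq_square)
      also note large
      also have "K * (real k)\<^sup>2 * (\<Sum>I\<in>?L. \<Sum>J\<in>?L. e I * e J * re (q I J)) \<le> K * (real k)\<^sup>2 * (M * ?P)"
        using K by (intro mult_left_mono low) auto
      finally show ?thesis by (simp add: mult_ac)
    qed
    then have main: "t ^ k * (1 - \<delta>) ^ (2 * k) * M \<le> K * (real k)\<^sup>2 * ?P"
      using M0 by (rule mult_left_le_imp_le)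
    have pos: "0 < t ^ k * (1 - \<delta>) ^ (2 * k)" using t \<delta> by simp
    have P0: "?P > 0"
    proof -
      have "0 < K * (real k)\<^sup>2 * ?P" using main pos M0 by (meson less_le_trans mult_pos_pos)
      moreover have "K * (real k)\<^sup>2 > 0" using K k by simp
      ultimately show ?thesis by (rule zero_less_mult_pos)
    qed
    \<comment> \<open>The image of the zero tensor has the empty representation, hence projective
      norm at most 0.\<close>
    have "z \<noteq> 0"
    proof
      assume "z = 0"
      then have Tz0: "tensor_map sY k T z A = (\<Sum>i\<in>{}. (0::'k) * elementary_tensor sY k [] A)" for A
        by (simp add: tensor_map_def)
      have "?P \<le> (\<Sum>i\<in>{}. norm (0::'k) * (\<Prod>j<k. nY ([] ! j)))"
        by (rule Y.projective_norm_le_weighted_sum[OF _ _ k Tz0]) auto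
      with P0 show False by simp
    qed
    moreover have "t ^ k * (1 - \<delta>) ^ (2 * k) * injective_norm sX nX k z \<le> K * (real k)\<^sup>2 * ?P"
      using mult_left_mono[OF inj_le less_imp_le[OF pos]] main by linarith
    ultimately show ?thesis using z P0 by blast
  qed
  with K show ?thesis by blast
qed

subsection \<open>The tensor radius\<close>

lemma tensor_ratio_le:
  assumes T: "linear_map T" and k: "k \<ge> 1" and z: "z \<in> tensor_power sX k"
  shows "projective_norm sY nY k (tensor_map sY k T z) \<le> nuclear_norm sX nX sY nY T ^ k * injective_norm sX nX k z"
proof -
  let ?N = "nuclear_norm sX nX sY nY T" and ?P = "projective_norm sY nY k (tensor_map sY k T z)"
    and ?I = "injective_norm sX nX k z"
  have "?P \<le> (?N + e) ^ k * ?I" if e: "e > 0" for e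
  proof -
    obtain m :: nat and h y where h: "\<forall>i<m. h i \<in> dual_ball sX nX" "\<forall>x. T x = (\<Sum>i<m. sY (h i x) (y i))"
      "(\<Sum>i<m. nY (y i)) < ?N + e"
      using nuclear_representation[OF T e] by blast
    have "?P \<le> (\<Sum>i<m. nY (y i)) ^ k * ?I"
      by (rule projective_norm_tensor_map_le[OF T _ _ z k]) (use h in auto)
    also have "\<dots> \<le> (?N + e) ^ k * ?I"
      using h(3) by (intro mult_right_mono power_mono X.injective_norm_ge_0[OF z] sum_nonneg) auto
    finally show ?thesis .
  qed
  then have "eventually (\<lambda>e. ?P \<le> (?N + e) ^ k * ?I) (at_right 0)"
    by (auto simp: eventually_at_right_field intro: exI[of _ 1])
  moreover have "((\<lambda>e. (?N + e) ^ k * ?I) \<longlongrightarrow> (?N + 0) ^ k * ?I) (at_right 0)"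
    by (intro tendsto_intros)
  ultimately have "?P \<le> (?N + 0) ^ k * ?I"
    by (intro tendsto_lowerbound[of "\<lambda>e. (?N + e) ^ k * ?I"]) (auto simp: trivial_limit_at_right_real)
  then show ?thesis by simp
qed

text \<open>If the injective norm is 0, division by 0 makes the quotient 0 and the bound is
  trivial.\<close>

lemma tensor_quotient_le:
  assumes T: "linear_map T" and k: "k \<ge> 1" and z: "z \<in> tensor_power sX k"
  shows "projective_norm sY nY k (tensor_map sY k T z) / injective_norm sX nX k z \<le> nuclear_norm sX nX sY nY T ^ k"
  using tensor_ratio_le[OF assms] X.injective_norm_ge_0[OF z] nuclear_norm_ge_0[OF T]
  by (cases "injective_norm sX nX k z = 0") (auto simp: divide_le_eq)

lemma tensor_tau_le:
  assumes T: "linear_map T" and k: "k \<ge> 1"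
  shows "tensor_tau sX nX sY nY k T \<le> nuclear_norm sX nX sY nY T"
proof -
  let ?N = "nuclear_norm sX nX sY nY T"
  have N: "?N \<ge> 0" by (rule nuclear_norm_ge_0[OF T])
  have "tensor_tau sX nX sY nY k T \<le> root k (?N ^ k)"
    unfolding tensor_tau_def
    using k N tensor_quotient_le[OF T k] by (intro real_root_le_mono cSup_least) auto
  also have "\<dots> = ?N" using k N by (simp add: real_root_power_cancel)
  finally show ?thesis .
qed

text \<open>The case \<open>c = 0\<close> corresponds to the 0 inserted in
  \<open>tensor_tau\<close>; it gives nonnegativity even when there is no nonzero tensor.\<close>

lemma le_tensor_tau:
  assumes T: "linear_map T" and k: "k \<ge> 1"
    and c: "c = 0 \<or> (\<exists>z\<in>tensor_power sX k. z \<noteq> 0 \<and> c \<le> projective_norm sY nY k (tensor_map sY k T z) / injective_norm sX nX k z)"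
  shows "root k c \<le> tensor_tau sX nX sY nY k T"
proof -
  let ?S = "insert 0 {projective_norm sY nY k (tensor_map sY k T z) / injective_norm sX nX k z | z.
          z \<in> tensor_power sX k \<and> z \<noteq> 0}"
  have bdd: "bdd_above ?S"
    using tensor_quotient_le[OF T k] nuclear_norm_ge_0[OF T]
    by (intro bdd_aboveI[of _ "nuclear_norm sX nX sY nY T ^ k"]) auto
  have "\<exists>s\<in>?S. c \<le> s" using c by blast
  then have "c \<le> Sup ?S" using cSup_upper[OF _ bdd] by (meson order_trans)
  then show ?thesis unfolding tensor_tau_def using k by (intro real_root_le_mono) auto
qed

lemma tensor_tau_ge:
  assumes T: "linear_map T" and tr: "trace_through_l2 T (nuclear_norm sX nX sY nY T) n x g" and \<delta>: "0 < \<delta>" "\<delta> < 1"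
  shows "\<exists>K>0. \<forall>k\<ge>1. nuclear_norm sX nX sY nY T * (1 - \<delta>)\<^sup>2 / (root k K * (root k k)\<^sup>2) \<le> tensor_tau sX nX sY nY k T"
proof (cases "nuclear_norm sX nX sY nY T = 0")
  case True
  have "0 \<le> tensor_tau sX nX sY nY k T" if "k \<ge> 1" for k
    using le_tensor_tau[OF T that, of 0] by simp
  then show ?thesis using True by (intro exI[of _ 1]) simp
next
  case False
  let ?N = "nuclear_norm sX nX sY nY T"
  have N: "?N > 0" using False nuclear_norm_ge_0[OF T] by simp
  obtain K where K: "K > 0" and ratio: "\<And>k. k \<ge> 1 \<Longrightarrow> \<exists>z\<in>tensor_power sX k. z \<noteq> 0 \<and>
    projective_norm sY nY k (tensor_map sY k T z) > 0 \<and>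
    ?N ^ k * (1 - \<delta>) ^ (2 * k) * injective_norm sX nX k z \<le>
      K * (real k)\<^sup>2 * projective_norm sY nY k (tensor_map sY k T z)"
    using exists_tensor_large_ratio[OF T N tr \<delta>] by blast
  have "?N * (1 - \<delta>)\<^sup>2 / (root k K * (root k k)\<^sup>2) \<le> tensor_tau sX nX sY nY k T" if k: "k \<ge> 1" for k
  proof -
    obtain z where z: "z \<in> tensor_power sX k" "z \<noteq> 0"
      and P: "projective_norm sY nY k (tensor_map sY k T z) > 0"
      and le: "?N ^ k * (1 - \<delta>) ^ (2 * k) * injective_norm sX nX k z \<le>
        K * (real k)\<^sup>2 * projective_norm sY nY k (tensor_map sY k T z)"
      using ratio[OF k] by blast
    \<comment> \<open>A zero injective norm would force the image to have projective norm at most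
      0.\<close>
    have "injective_norm sX nX k z \<noteq> 0"
      using tensor_ratio_le[OF T k z(1)] P by auto
    then have I: "injective_norm sX nX k z > 0"
      using X.injective_norm_ge_0[OF z(1)] by simp
    have Kk: "K * (real k)\<^sup>2 > 0" using K k by simp
    have "?N ^ k * (1 - \<delta>) ^ (2 * k) / (K * (real k)\<^sup>2) \<le>
        projective_norm sY nY k (tensor_map sY k T z) / injective_norm sX nX k z"
      using le I Kk by (simp add: divide_le_eq le_divide_eq mult_ac)
    then have "root k (?N ^ k * (1 - \<delta>) ^ (2 * k) / (K * (real k)\<^sup>2)) \<le> tensor_tau sX nX sY nY k T"
      using z by (intro le_tensor_tau[OF T k]) blast
    also have "?N ^ k * (1 - \<delta>) ^ (2 * k) = (?N * (1 - \<delta>)\<^sup>2) ^ k"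
      by (simp only: power_mult power_mult_distrib)
    finally show ?thesis
      using k N by (simp add: real_root_divide real_root_mult real_root_power_cancel real_root_power)
  qed
  with K show ?thesis by blast
qed

lemma nuclear_tensorization:
  assumes eucl: "euclidean_norm cj sX nX \<or> euclidean_norm cj sY nY"
  shows "nuclear_tensorization_property sX nX sY nY"
  unfolding nuclear_tensorization_property_def
proof (intro allI impI)
  fix T assume T: "linear_map T"
  let ?N = "nuclear_norm sX nX sY nY T" and ?\<tau> = "\<lambda>k. tensor_tau sX nX sY nY k T"
  obtain n x g where tr: "trace_through_l2 T ?N n x g"
    using trace_through_l2_domain[OF T] trace_through_l2_codomain[OF T] eucl by blast
  have "?\<tau> \<longlonglongrightarrow> ?N"
  proof (rule order_tendstoI)
    fix a assume "a < ?N"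
    \<comment> \<open>\<open>K\<close> depends on \<open>\<delta>\<close>, so
      \<open>\<delta>\<close> is fixed, close enough to 0 for the given \<open>a\<close>, before
      \<open>k\<close> tends to infinity and \<open>root k K\<close> and \<open>root k k\<close>
      tend to 1.\<close>
    have "((\<lambda>\<delta>. ?N * (1 - \<delta>)\<^sup>2) \<longlongrightarrow> ?N * (1 - 0)\<^sup>2) (at_right 0)"
      by (intro tendsto_intros)
    then have "eventually (\<lambda>\<delta>. a < ?N * (1 - \<delta>)\<^sup>2) (at_right 0)"
      using \<open>a < ?N\<close> by (intro order_tendstoD) auto
    moreover have "eventually (\<lambda>\<delta>. \<delta> \<in> {0<..<1::real}) (at_right 0)"
      by (rule eventually_at_right_real) simp
    ultimately have "eventually (\<lambda>\<delta>. a < ?N * (1 - \<delta>)\<^sup>2 \<and> \<delta> \<in> {0<..<1}) (at_right 0)"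
      by (rule eventually_conj)
    then obtain \<delta> where \<delta>: "a < ?N * (1 - \<delta>)\<^sup>2" "0 < \<delta>" "\<delta> < 1"
      using eventually_happens'[OF trivial_limit_at_right_real] by force
    obtain K where K: "K > 0" "\<And>k. k \<ge> 1 \<Longrightarrow> ?N * (1 - \<delta>)\<^sup>2 / (root k K * (root k k)\<^sup>2) \<le> ?\<tau> k"
      using tensor_tau_ge[OF T tr \<delta>(2,3)] by blast
    have "(\<lambda>k. ?N * (1 - \<delta>)\<^sup>2 / (root k K * (root k k)\<^sup>2)) \<longlonglongrightarrow> ?N * (1 - \<delta>)\<^sup>2 / (1 * 1\<^sup>2)"
      using K(1) by (intro tendsto_intros LIMSEQ_root LIMSEQ_root_const) auto
    then have "eventually (\<lambda>k. a < ?N * (1 - \<delta>)\<^sup>2 / (root k K * (root k k)\<^sup>2)) sequentially"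
      using \<delta>(1) by (intro order_tendstoD) auto
    then show "eventually (\<lambda>k. a < ?\<tau> k) sequentially"
      using eventually_ge_at_top[of 1]
      by eventually_elim (use K(2) in \<open>auto intro: less_le_trans\<close>)
  next
    fix a assume "?N < a"
    then show "eventually (\<lambda>k. ?\<tau> k < a) sequentially"
      by (intro eventually_mono[OF eventually_ge_at_top[of 1]]) (rule le_less_trans[OF tensor_tau_le[OF T]])
  qed
  then show "convergent ?\<tau> \<and> tensor_radius sX nX sY nY T = ?N"
    unfolding tensor_radius_def by (auto intro: convergentI limI)
qed

end

section \<open>The two scalar fields\<close>

lemma scalars_real: "scalars (\<lambda>c. c) (\<lambda>c. c) (\<lambda>_. 0) (0::real)"
  by unfold_locales (auto simp: algebra_simps power2_eq_square)

lemma scalars_complex: "scalars cnj Re Im \<i>"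
  by unfold_locales
    (auto simp: complex_eq_iff cmod_power2 complex_mult_cnj)

theorem theorem1p4:
  "(\<forall>(sX :: real \<Rightarrow> 'a::ab_group_add \<Rightarrow> 'a) nX (sY :: real \<Rightarrow> 'b::ab_group_add \<Rightarrow> 'b) nY.
      fin_dim_normed_space sX nX \<longrightarrow> fin_dim_normed_space sY nY \<longrightarrow>
      euclidean_norm (\<lambda>c. c) sX nX \<or> euclidean_norm (\<lambda>c. c) sY nY \<longrightarrow>
      nuclear_tensorization_property sX nX sY nY) \<and>
   (\<forall>(sX :: complex \<Rightarrow> 'a \<Rightarrow> 'a) nX (sY :: complex \<Rightarrow> 'b \<Rightarrow> 'b) nY.
      fin_dim_normed_space sX nX \<longrightarrow> fin_dim_normed_space sY nY \<longrightarrow>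
      euclidean_norm cnj sX nX \<or> euclidean_norm cnj sY nY \<longrightarrow>
      nuclear_tensorization_property sX nX sY nY)"
proof (intro conjI allI impI)
  fix sX :: "real \<Rightarrow> 'a \<Rightarrow> 'a" and nX and sY :: "real \<Rightarrow> 'b \<Rightarrow> 'b" and nY
  assume *: "fin_dim_normed_space sX nX" "fin_dim_normed_space sY nY"
    and eucl: "euclidean_norm (\<lambda>c. c) sX nX \<or> euclidean_norm (\<lambda>c. c) sY nY"
  interpret scalar_normed_pair "\<lambda>c. c" "\<lambda>c. c" "\<lambda>_. 0" 0 sX nX sY nY
    using scalars_real * by (intro scalar_normed_pair.intro scalar_normed_space.intro)
  show "nuclear_tensorization_property sX nX sY nY"
    by (rule nuclear_tensorization[OF eucl])
next
  fix sX :: "complex \<Rightarrow> 'a \<Rightarrow> 'a" and nX and sY :: "complex \<Rightarrow> 'b \<Rightarrow> 'b" and nY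
  assume *: "fin_dim_normed_space sX nX" "fin_dim_normed_space sY nY"
    and eucl: "euclidean_norm cnj sX nX \<or> euclidean_norm cnj sY nY"
  interpret scalar_normed_pair cnj Re Im \<i> sX nX sY nY
    using scalars_complex * by (intro scalar_normed_pair.intro scalar_normed_space.intro)
  show "nuclear_tensorization_property sX nX sY nY"
    by (rule nuclear_tensorization[OF eucl])
qed

end
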